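(* Let $X$ be a connected unitary Frobenius algebra in a unitary tensor category. Then the unitary Frobenius subalgebra lattice of $X$ is finite.
   Context: A unitary tensor category is a tensor category over $\mathbb{C}$ (locally finite linear abelian rigid monoidal, bilinear tensor product, $\mathrm{End}(\mathbf 1)=\mathbb{C}$; taken strict) equipped with a dagger functor $f\mapsto f^\dagger$ (identity on objects, sending $f:A\to B$ to $f^\dagger:B\to A$, conjugate-linear, involutive, contravariant, compatible with $\otimes$) making it a $C^*$-category: for each $f:A\to B$ there is $g\in\mathrm{End}(A)$ with $f^\dagger\circ f=g^\dagger\circ g$, and the associated $C^*$-norms are complete norms. It has a canonical spherical structure; $\dim(C)$ is the corresponding categorical dimension. A left dual of $X$ is $(X^*,\mathrm{ev}_X:X^*\otimes X\to\mathbf 1,\mathrm{coev}_X:\mathbf 1\to X\otimes X^* )$ satisfying the zigzag identities; $f^*$ denotes the dual morphism of $f$. A Frobenius algebra is $(X,m,\delta,e,\epsilon)$ with $(X,m,e)$ a unital algebra, $(X,\delta,\epsilon)$ a counital coalgebra and $(\mathrm{id}_X\otimes m)\circ(\delta\otimes \mathrm{id}_X)=\delta\circ m=(m\otimes \mathrm{id}_X)\circ(\mathrm{id}_X\otimes\delta)$. It is always regarded as selfdual, $X^*=X$, with $\mathrm{ev}_X=\epsilon\circ m$, $\mathrm{coev}_X=\delta\circ e$. $X$ is connected if $\dim\mathrm{Hom}(\mathbf 1,X)=1$. A Frobenius algebra $(C,m,e,\delta,\epsilon)$ in a unitary tensor category is unitary if: it is separable, i.e. $m\circ\delta=\lambda\,\mathrm{id}_C$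 for some nonzero scalar $\lambda$; $\epsilon\circ m\circ\delta\circ e=\dim(C)\,\mathrm{id}_{\mathbf 1}$; and $m^\dagger=\delta$, $e^\dagger=\epsilon$. A Frobenius algebra $X'$ is a Frobenius subalgebra of $X$ if there is a unital algebra monomorphism $i:X'\to X$ with $i^{**}=i$ and $i^*\circ i=\mathrm{id}_{X'}$; put $b_{X'}:=i\circ i^*$. Two Frobenius subalgebras $X_1,X_2$ are equivalent iff $b_{X_1}=b_{X_2}$; the Frobenius subalgebra poset is the set of equivalence classes with $[X_1]\le[X_2]$ iff $b_{X_1}\circ b_{X_2}=b_{X_1}=b_{X_2}\circ b_{X_1}$. The unitary Frobenius subalgebra lattice of $X$ is the subposet of classes of Frobenius subalgebras that are themselves unitary Frobenius algebras (this subposet is a lattice with $[A]\wedge[B]=[A\cap B]$). *)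

theory Defs
  imports Complex_Main "HOL-Algebra.Order"
begin

section \<open>Linear and abelian categories\<close>

text \<open>
  The objects are all elements of the type \<open>'o\<close>. The spaces \<open>Hom C A B\<close> are
  subspaces of one ambient complex vector space \<open>'m\<close>; every small linear category has this
  shape, with the direct sum of its morphism spaces as ambient space. The spaces share
  the zero vector and so are not disjoint: source and target are never read off a morphism but
  are always given explicitly. \<open>comp\<close>, \<open>tens\<close> and \<open>dag\<close> are constrained
  only on morphisms of matching type. Composition is written in the usual order,
  \<open>g \<cdot> f\<close> meaning \<open>g\<close> after \<open>f\<close>.
\<close>

record ('o, 'm) dagger_monoidal =
  Hom :: "'o \<Rightarrow> 'o \<Rightarrow> 'm set"
  scl :: "complex \<Rightarrow> 'm \<Rightarrow> 'm"
  ident :: "'o \<Rightarrow> 'm"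
  comp :: "'m \<Rightarrow> 'm \<Rightarrow> 'm" (infixr "\<cdot>\<index>" 70)
  unit_obj :: "'o"
  tobj :: "'o \<Rightarrow> 'o \<Rightarrow> 'o" (infixr "\<boxtimes>\<index>" 75)
  tens :: "'m \<Rightarrow> 'm \<Rightarrow> 'm" (infixr "\<otimes>\<index>" 75)
  dag :: "'m \<Rightarrow> 'm"

locale linear_category = vector_space "scl C"
  for C :: "('o, 'm::ab_group_add) dagger_monoidal" (structure) +
  assumes subspace_Hom: "subspace (Hom C A B)"
    and ident_in_Hom: "ident C A \<in> Hom C A A"
    and comp_in_Hom: "\<lbrakk>f \<in> Hom C A B; g \<in> Hom C B D\<rbrakk> \<Longrightarrow> g \<cdot> f \<in> Hom C A D"
    and comp_ident: "f \<in> Hom C A B \<Longrightarrow> f \<cdot> ident C A = f"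
    and ident_comp: "f \<in> Hom C A B \<Longrightarrow> ident C B \<cdot> f = f"
    and comp_assoc: "\<lbrakk>f \<in> Hom C A B; g \<in> Hom C B D; h \<in> Hom C D E\<rbrakk>
      \<Longrightarrow> (h \<cdot> g) \<cdot> f = h \<cdot> (g \<cdot> f)"
    and comp_add_right: "\<lbrakk>f \<in> Hom C A B; f' \<in> Hom C A B; g \<in> Hom C B D\<rbrakk>
      \<Longrightarrow> g \<cdot> (f + f') = g \<cdot> f + g \<cdot> f'"
    and comp_add_left: "\<lbrakk>f \<in> Hom C A B; g \<in> Hom C B D; g' \<in> Hom C B D\<rbrakk>
      \<Longrightarrow> (g + g') \<cdot> f = g \<cdot> f + g' \<cdot> f"
    and comp_scl_right: "\<lbrakk>f \<in> Hom C A B; g \<in> Hom C B D\<rbrakk> \<Longrightarrow> g \<cdot> scl C z f = scl C z (g \<cdot> f)"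
    and comp_scl_left: "\<lbrakk>f \<in> Hom C A B; g \<in> Hom C B D\<rbrakk> \<Longrightarrow> scl C z g \<cdot> f = scl C z (g \<cdot> f)"

definition is_iso where
  "is_iso C A B f \<longleftrightarrow> f \<in> Hom C A B \<and>
     (\<exists>g \<in> Hom C B A. g \<cdot>\<^bsub>C\<^esub> f = ident C A \<and> f \<cdot>\<^bsub>C\<^esub> g = ident C B)"

definition is_mono where
  "is_mono C A B f \<longleftrightarrow> f \<in> Hom C A B \<and>
     (\<forall>D. \<forall>g \<in> Hom C D A. \<forall>h \<in> Hom C D A. f \<cdot>\<^bsub>C\<^esub> g = f \<cdot>\<^bsub>C\<^esub> h \<longrightarrow> g = h)"

definition is_epi where
  "is_epi C A B f \<longleftrightarrow> f \<in> Hom C A B \<and>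
     (\<forall>D. \<forall>g \<in> Hom C B D. \<forall>h \<in> Hom C B D. g \<cdot>\<^bsub>C\<^esub> f = h \<cdot>\<^bsub>C\<^esub> f \<longrightarrow> g = h)"

definition is_kernel where
  "is_kernel C A B f K k \<longleftrightarrow> f \<in> Hom C A B \<and> k \<in> Hom C K A \<and> f \<cdot>\<^bsub>C\<^esub> k = 0 \<and>
     (\<forall>D. \<forall>g \<in> Hom C D A. f \<cdot>\<^bsub>C\<^esub> g = 0 \<longrightarrow> (\<exists>!h. h \<in> Hom C D K \<and> k \<cdot>\<^bsub>C\<^esub> h = g))"

definition is_cokernel where
  "is_cokernel C A B f Q q \<longleftrightarrow> f \<in> Hom C A B \<and> q \<in> Hom C B Q \<and> q \<cdot>\<^bsub>C\<^esub> f = 0 \<and>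
     (\<forall>D. \<forall>g \<in> Hom C B D. g \<cdot>\<^bsub>C\<^esub> f = 0 \<longrightarrow> (\<exists>!h. h \<in> Hom C Q D \<and> h \<cdot>\<^bsub>C\<^esub> q = g))"

definition is_zero_obj where
  "is_zero_obj C Z \<longleftrightarrow> (\<forall>A. Hom C A Z = {0} \<and> Hom C Z A = {0})"

definition is_simple where
  "is_simple C S \<longleftrightarrow> \<not> is_zero_obj C S \<and>
     (\<forall>T j. is_mono C T S j \<longrightarrow> is_zero_obj C T \<or> is_iso C T S j)"

inductive finite_length :: "('o, 'm::ab_group_add) dagger_monoidal \<Rightarrow> 'o \<Rightarrow> bool" for C where
  zero: "is_zero_obj C Z \<Longrightarrow> finite_length C Z"
| extend: "\<lbrakk>finite_length C A; is_mono C A B j; is_cokernel C A B j S q; is_simple C S\<rbrakk>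
    \<Longrightarrow> finite_length C B"

locale locally_finite_abelian_category = linear_category +
  assumes zero_obj_exists: "\<exists>Z. is_zero_obj C Z"
    and biproduct_exists: "\<exists>S. \<exists>i\<^sub>1 \<in> Hom C A S. \<exists>i\<^sub>2 \<in> Hom C B S. \<exists>p\<^sub>1 \<in> Hom C S A. \<exists>p\<^sub>2 \<in> Hom C S B.
      p\<^sub>1 \<cdot> i\<^sub>1 = ident C A \<and> p\<^sub>2 \<cdot> i\<^sub>2 = ident C B \<and> i\<^sub>1 \<cdot> p\<^sub>1 + i\<^sub>2 \<cdot> p\<^sub>2 = ident C S"
    and kernel_exists: "f \<in> Hom C A B \<Longrightarrow> \<exists>K k. is_kernel C A B f K k"
    and cokernel_exists: "f \<in> Hom C A B \<Longrightarrow> \<exists>Q q. is_cokernel C A B f Q q"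
    and mono_is_kernel: "is_mono C K A k \<Longrightarrow> \<exists>B f. is_kernel C A B f K k"
    and epi_is_cokernel: "is_epi C B Q q \<Longrightarrow> \<exists>A f. is_cokernel C A B f Q q"
    and Hom_finite_dim: "\<exists>S. finite S \<and> span S = Hom C A B"
    and finite_length: "finite_length C A"

section \<open>Strict tensor categories\<close>

definition left_dual where
  "left_dual C X Y ev coev \<longleftrightarrow>
     ev \<in> Hom C (Y \<boxtimes>\<^bsub>C\<^esub> X) (unit_obj C) \<and> coev \<in> Hom C (unit_obj C) (X \<boxtimes>\<^bsub>C\<^esub> Y) \<and>
     (ident C X \<otimes>\<^bsub>C\<^esub> ev) \<cdot>\<^bsub>C\<^esub> (coev \<otimes>\<^bsub>C\<^esub> ident C X) = ident C X \<and>
     (ev \<otimes>\<^bsub>C\<^esub> ident C Y) \<cdot>\<^bsub>C\<^esub> (ident C Y \<otimes>\<^bsub>C\<^esub> coev) = ident C Y"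

text \<open>
  The dual \<open>B\<^sup>* \<rightarrow> A\<^sup>*\<close> of \<open>f : A \<rightarrow> B\<close>, where \<open>Ad\<close> and \<open>Bd\<close> are left duals of
  \<open>A\<close> and \<open>B\<close>, with coevaluation \<open>coevA\<close> and evaluation \<open>evB\<close>.
\<close>

definition dual_mor where
  "dual_mor C Ad coevA Bd evB f =
     (evB \<otimes>\<^bsub>C\<^esub> ident C Ad) \<cdot>\<^bsub>C\<^esub> (ident C Bd \<otimes>\<^bsub>C\<^esub> f \<otimes>\<^bsub>C\<^esub> ident C Ad) \<cdot>\<^bsub>C\<^esub> (ident C Bd \<otimes>\<^bsub>C\<^esub> coevA)"

locale strict_tensor_category = locally_finite_abelian_category +
  assumes tobj_assoc: "(A \<boxtimes> B) \<boxtimes> D = A \<boxtimes> (B \<boxtimes> D)"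
    and tobj_unit_left: "unit_obj C \<boxtimes> A = A"
    and tobj_unit_right: "A \<boxtimes> unit_obj C = A"
    and tens_in_Hom: "\<lbrakk>f \<in> Hom C A B; g \<in> Hom C D E\<rbrakk> \<Longrightarrow> f \<otimes> g \<in> Hom C (A \<boxtimes> D) (B \<boxtimes> E)"
    and tens_ident: "ident C A \<otimes> ident C B = ident C (A \<boxtimes> B)"
    and tens_comp: "\<lbrakk>f \<in> Hom C A A'; f' \<in> Hom C A' A''; g \<in> Hom C B B'; g' \<in> Hom C B' B''\<rbrakk>
      \<Longrightarrow> (f' \<cdot> f) \<otimes> (g' \<cdot> g) = (f' \<otimes> g') \<cdot> (f \<otimes> g)"
    and tens_assoc: "\<lbrakk>f \<in> Hom C A A'; g \<in> Hom C B B'; h \<in> Hom C D D'\<rbrakk>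
      \<Longrightarrow> (f \<otimes> g) \<otimes> h = f \<otimes> (g \<otimes> h)"
    and tens_unit_left: "f \<in> Hom C A B \<Longrightarrow> ident C (unit_obj C) \<otimes> f = f"
    and tens_unit_right: "f \<in> Hom C A B \<Longrightarrow> f \<otimes> ident C (unit_obj C) = f"
    and tens_add_left: "\<lbrakk>f \<in> Hom C A B; f' \<in> Hom C A B; g \<in> Hom C D E\<rbrakk>
      \<Longrightarrow> (f + f') \<otimes> g = f \<otimes> g + f' \<otimes> g"
    and tens_add_right: "\<lbrakk>f \<in> Hom C A B; g \<in> Hom C D E; g' \<in> Hom C D E\<rbrakk>
      \<Longrightarrow> f \<otimes> (g + g') = f \<otimes> g + f \<otimes> g'"
    and tens_scl_left: "\<lbrakk>f \<in> Hom C A B; g \<in> Hom C D E\<rbrakk> \<Longrightarrow> scl C z f \<otimes> g = scl C z (f \<otimes> g)"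
    and tens_scl_right: "\<lbrakk>f \<in> Hom C A B; g \<in> Hom C D E\<rbrakk> \<Longrightarrow> f \<otimes> scl C z g = scl C z (f \<otimes> g)"
    and left_dual_exists: "\<exists>Y ev coev. left_dual C X Y ev coev"
    and right_dual_exists: "\<exists>Y ev coev. left_dual C Y X ev coev"
    and End_unit: "bij_betw (\<lambda>z. scl C z (ident C (unit_obj C))) UNIV (Hom C (unit_obj C) (unit_obj C))"

section \<open>Unitary tensor categories\<close>

definition spec :: "('o, 'm::ab_group_add) dagger_monoidal \<Rightarrow> 'o \<Rightarrow> 'm \<Rightarrow> complex set" where
  "spec C A h = {z. \<not> is_iso C A A (h - scl C z (ident C A))}"

text \<open>
  The C*-norm of a morphism \<open>f\<close> with source \<open>A\<close>: its square is the spectral radius of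
  \<open>f\<^sup>\<dagger>f\<close>. Inserting 0 gives the supremum its value 0 when the spectrum is empty, which
  happens if \<open>A\<close> is a zero object.
\<close>

definition cnorm :: "('o, 'm::ab_group_add) dagger_monoidal \<Rightarrow> 'o \<Rightarrow> 'm \<Rightarrow> real" where
  "cnorm C A f = sqrt (Sup (insert 0 (cmod ` spec C A (dag C f \<cdot>\<^bsub>C\<^esub> f))))"

locale unitary_tensor_category = strict_tensor_category +
  assumes dag_in_Hom: "f \<in> Hom C A B \<Longrightarrow> dag C f \<in> Hom C B A"
    and dag_add: "\<lbrakk>f \<in> Hom C A B; g \<in> Hom C A B\<rbrakk> \<Longrightarrow> dag C (f + g) = dag C f + dag C g"
    and dag_scl: "f \<in> Hom C A B \<Longrightarrow> dag C (scl C z f) = scl C (cnj z) (dag C f)"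
    and dag_dag: "f \<in> Hom C A B \<Longrightarrow> dag C (dag C f) = f"
    and dag_ident: "dag C (ident C A) = ident C A"
    and dag_comp: "\<lbrakk>f \<in> Hom C A B; g \<in> Hom C B D\<rbrakk> \<Longrightarrow> dag C (g \<cdot> f) = dag C f \<cdot> dag C g"
    and dag_tens: "\<lbrakk>f \<in> Hom C A B; g \<in> Hom C D E\<rbrakk> \<Longrightarrow> dag C (f \<otimes> g) = dag C f \<otimes> dag C g"
    and positivity: "f \<in> Hom C A B \<Longrightarrow> \<exists>g \<in> Hom C A A. dag C f \<cdot> f = dag C g \<cdot> g"
    and cnorm_finite: "f \<in> Hom C A B \<Longrightarrow> bdd_above (cmod ` spec C A (dag C f \<cdot> f))"
    and cnorm_definite: "\<lbrakk>f \<in> Hom C A B; cnorm C A f = 0\<rbrakk> \<Longrightarrow> f = 0"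
    and cnorm_scl: "f \<in> Hom C A B \<Longrightarrow> cnorm C A (scl C z f) = cmod z * cnorm C A f"
    and cnorm_triangle: "\<lbrakk>f \<in> Hom C A B; g \<in> Hom C A B\<rbrakk>
      \<Longrightarrow> cnorm C A (f + g) \<le> cnorm C A f + cnorm C A g"
    and cnorm_comp: "\<lbrakk>f \<in> Hom C A B; g \<in> Hom C B D\<rbrakk>
      \<Longrightarrow> cnorm C A (g \<cdot> f) \<le> cnorm C B g * cnorm C A f"
    and cnorm_cstar: "f \<in> Hom C A B \<Longrightarrow> cnorm C A (dag C f \<cdot> f) = (cnorm C A f)\<^sup>2"
    and cnorm_complete: "\<lbrakk>\<And>n. s n \<in> Hom C A B;
        \<And>\<epsilon>. \<epsilon> > 0 \<Longrightarrow> \<exists>N. \<forall>m\<ge>N. \<forall>n\<ge>N. cnorm C A (s m - s n) < \<epsilon>\<rbrakk>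
      \<Longrightarrow> \<exists>l \<in> Hom C A B. (\<lambda>n::nat. cnorm C A (s n - l)) \<longlonglongrightarrow> 0"

text \<open>
  The canonical spherical structure is given by the standard duals: those for which the
  left and the right trace, formed with evaluation, coevaluation and their adjoints, agree on
  \<open>End X\<close>. They are unique up to a unitary, so the dimension, the common trace of
  the identity, does not depend on the choice.
\<close>

definition standard_dual where
  "standard_dual C X Y ev coev \<longleftrightarrow> left_dual C X Y ev coev \<and>
     (\<forall>f \<in> Hom C X X.
        dag C coev \<cdot>\<^bsub>C\<^esub> (f \<otimes>\<^bsub>C\<^esub> ident C Y) \<cdot>\<^bsub>C\<^esub> coev = ev \<cdot>\<^bsub>C\<^esub> (ident C Y \<otimes>\<^bsub>C\<^esub> f) \<cdot>\<^bsub>C\<^esub> dag C ev)"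

definition cat_dim :: "('o, 'm::ab_group_add) dagger_monoidal \<Rightarrow> 'o \<Rightarrow> complex" where
  "cat_dim C X = (THE d. \<exists>Y ev coev. standard_dual C X Y ev coev \<and>
     dag C coev \<cdot>\<^bsub>C\<^esub> coev = scl C d (ident C (unit_obj C)))"

section \<open>Frobenius algebras\<close>

record ('o, 'm) frobenius =
  fobj :: "'o"
  mult :: "'m"
  comult :: "'m"
  funit :: "'m"
  counit :: "'m"

definition unital_algebra where
  "unital_algebra C X m e \<longleftrightarrow>
     m \<in> Hom C (X \<boxtimes>\<^bsub>C\<^esub> X) X \<and> e \<in> Hom C (unit_obj C) X \<and>
     m \<cdot>\<^bsub>C\<^esub> (m \<otimes>\<^bsub>C\<^esub> ident C X) = m \<cdot>\<^bsub>C\<^esub> (ident C X \<otimes>\<^bsub>C\<^esub> m) \<and>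
     m \<cdot>\<^bsub>C\<^esub> (e \<otimes>\<^bsub>C\<^esub> ident C X) = ident C X \<and>
     m \<cdot>\<^bsub>C\<^esub> (ident C X \<otimes>\<^bsub>C\<^esub> e) = ident C X"

definition counital_coalgebra where
  "counital_coalgebra C X \<delta> \<epsilon> \<longleftrightarrow>
     \<delta> \<in> Hom C X (X \<boxtimes>\<^bsub>C\<^esub> X) \<and> \<epsilon> \<in> Hom C X (unit_obj C) \<and>
     (\<delta> \<otimes>\<^bsub>C\<^esub> ident C X) \<cdot>\<^bsub>C\<^esub> \<delta> = (ident C X \<otimes>\<^bsub>C\<^esub> \<delta>) \<cdot>\<^bsub>C\<^esub> \<delta> \<and>
     (\<epsilon> \<otimes>\<^bsub>C\<^esub> ident C X) \<cdot>\<^bsub>C\<^esub> \<delta> = ident C X \<and>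
     (ident C X \<otimes>\<^bsub>C\<^esub> \<epsilon>) \<cdot>\<^bsub>C\<^esub> \<delta> = ident C X"

definition frobenius_algebra ::
    "('o, 'm::ab_group_add) dagger_monoidal \<Rightarrow> ('o, 'm) frobenius \<Rightarrow> bool" where
  "frobenius_algebra C F \<longleftrightarrow>
     unital_algebra C (fobj F) (mult F) (funit F) \<and>
     counital_coalgebra C (fobj F) (comult F) (counit F) \<and>
     (ident C (fobj F) \<otimes>\<^bsub>C\<^esub> mult F) \<cdot>\<^bsub>C\<^esub> (comult F \<otimes>\<^bsub>C\<^esub> ident C (fobj F)) = comult F \<cdot>\<^bsub>C\<^esub> mult F \<and>
     (mult F \<otimes>\<^bsub>C\<^esub> ident C (fobj F)) \<cdot>\<^bsub>C\<^esub> (ident C (fobj F) \<otimes>\<^bsub>C\<^esub> comult F) = comult F \<cdot>\<^bsub>C\<^esub> mult F"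

definition unitary_frobenius_algebra ::
    "('o, 'm::ab_group_add) dagger_monoidal \<Rightarrow> ('o, 'm) frobenius \<Rightarrow> bool" where
  "unitary_frobenius_algebra C F \<longleftrightarrow> frobenius_algebra C F \<and>
     (\<exists>z. z \<noteq> 0 \<and> mult F \<cdot>\<^bsub>C\<^esub> comult F = scl C z (ident C (fobj F))) \<and>
     counit F \<cdot>\<^bsub>C\<^esub> mult F \<cdot>\<^bsub>C\<^esub> comult F \<cdot>\<^bsub>C\<^esub> funit F
       = scl C (cat_dim C (fobj F)) (ident C (unit_obj C)) \<and>
     dag C (mult F) = comult F \<and> dag C (funit F) = counit F"

definition connected_frobenius ::
    "('o, 'm::ab_group_add) dagger_monoidal \<Rightarrow> ('o, 'm) frobenius \<Rightarrow> bool" where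
  "connected_frobenius C F \<longleftrightarrow> vector_space.dim (scl C) (Hom C (unit_obj C) (fobj F)) = 1"

section \<open>Frobenius subalgebras\<close>

text \<open>
  The dual \<open>f\<^sup>* : B \<rightarrow> A\<close> of \<open>f : A \<rightarrow> B\<close> for the selfdualities of the Frobenius algebras
  \<open>A\<close> and \<open>B\<close>, that is, \<open>ev = \<epsilon> \<cdot> m\<close> and \<open>coev = \<delta> \<cdot> e\<close>.
\<close>

definition frob_dual ::
    "('o, 'm::ab_group_add) dagger_monoidal \<Rightarrow> ('o, 'm) frobenius \<Rightarrow> ('o, 'm) frobenius \<Rightarrow> 'm \<Rightarrow> 'm" where
  "frob_dual C A B f =
     dual_mor C (fobj A) (comult A \<cdot>\<^bsub>C\<^esub> funit A) (fobj B) (counit B \<cdot>\<^bsub>C\<^esub> mult B) f"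

definition algebra_mono ::
    "('o, 'm::ab_group_add) dagger_monoidal \<Rightarrow> ('o, 'm) frobenius \<Rightarrow> ('o, 'm) frobenius \<Rightarrow> 'm \<Rightarrow> bool" where
  "algebra_mono C A B i \<longleftrightarrow> is_mono C (fobj A) (fobj B) i \<and>
     i \<cdot>\<^bsub>C\<^esub> mult A = mult B \<cdot>\<^bsub>C\<^esub> (i \<otimes>\<^bsub>C\<^esub> i) \<and> i \<cdot>\<^bsub>C\<^esub> funit A = funit B"

text \<open>A Frobenius subalgebra comes with its embedding, since \<open>i \<cdot> i\<^sup>*\<close> depends on it.\<close>

definition frobenius_subalgebras ::
    "('o, 'm::ab_group_add) dagger_monoidal \<Rightarrow> ('o, 'm) frobenius \<Rightarrow> (('o, 'm) frobenius \<times> 'm) set" where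
  "frobenius_subalgebras C X = {(X', i). frobenius_algebra C X' \<and> algebra_mono C X' X i \<and>
     frob_dual C X X' (frob_dual C X' X i) = i \<and>
     frob_dual C X' X i \<cdot>\<^bsub>C\<^esub> i = ident C (fobj X')}"

definition sub_proj ::
    "('o, 'm::ab_group_add) dagger_monoidal \<Rightarrow> ('o, 'm) frobenius \<Rightarrow> ('o, 'm) frobenius \<times> 'm \<Rightarrow> 'm" where
  "sub_proj C X = (\<lambda>(X', i). i \<cdot>\<^bsub>C\<^esub> frob_dual C X' X i)"

definition sub_equiv ::
    "('o, 'm::ab_group_add) dagger_monoidal \<Rightarrow> ('o, 'm) frobenius \<Rightarrow>
     ((('o, 'm) frobenius \<times> 'm) \<times> (('o, 'm) frobenius \<times> 'm)) set" where
  "sub_equiv C X = {(S, T). S \<in> frobenius_subalgebras C X \<and> T \<in> frobenius_subalgebras C X \<and>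
     sub_proj C X S = sub_proj C X T}"

definition frobenius_subalgebra_poset ::
    "('o, 'm::ab_group_add) dagger_monoidal \<Rightarrow> ('o, 'm) frobenius \<Rightarrow>
     (('o, 'm) frobenius \<times> 'm) set gorder" where
  "frobenius_subalgebra_poset C X =
     \<lparr>carrier = frobenius_subalgebras C X // sub_equiv C X,
      eq = (=),
      le = (\<lambda>P Q. \<exists>S \<in> P. \<exists>T \<in> Q.
        sub_proj C X S \<cdot>\<^bsub>C\<^esub> sub_proj C X T = sub_proj C X S \<and>
        sub_proj C X S = sub_proj C X T \<cdot>\<^bsub>C\<^esub> sub_proj C X S)\<rparr>"

definition unitary_frobenius_subalgebra_lattice ::
    "('o, 'm::ab_group_add) dagger_monoidal \<Rightarrow> ('o, 'm) frobenius \<Rightarrow>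
     (('o, 'm) frobenius \<times> 'm) set gorder" where
  "unitary_frobenius_subalgebra_lattice C X = (frobenius_subalgebra_poset C X)
     \<lparr>carrier := {P \<in> carrier (frobenius_subalgebra_poset C X).
        \<exists>(X', i) \<in> P. unitary_frobenius_algebra C X'}\<rparr>"

end

theory Submission
  imports Defs
begin

text \<open>
  Write \<open>b = i \<cdot> i\<^sup>*\<close> for the idempotent on \<open>X\<close> of a unitary Frobenius subalgebra
  \<open>i : A \<rightarrow> X\<close>. The class of the subalgebra is determined by \<open>b\<close>, and the claim is that only
  finitely many \<open>b\<close> occur. All of them lie in the finite-dimensional algebra \<open>End X\<close>, which
  the trace \<open>tr f = ev \<cdot> (f \<otimes> id) \<cdot> coev\<close> turns into a Hilbert space. They form a bounded set there
  whose distinct points keep a fixed distance, and such a set is finite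
  (\<open>finite_separated\<close>). The argument has three ideas.

  First, \<open>i\<^sup>* = i\<^sup>\<dagger>\<close>, although only the algebra structure of \<open>A\<close> is assumed to be
  compatible with \<open>i\<close> (\<open>adj_eq_transpose\<close>). Through \<open>i\<close> the object \<open>X\<close> is an
  \<open>A\<close>-module, and the coaction, the action with its leg \<open>A\<close> bent, is a module map from \<open>X\<close> into the free module
  \<open>A \<otimes> X\<close>. The coaction composed with its adjoint is linear over \<open>X\<close> from the other side, hence a scalar,
  because \<open>X\<close> is connected. So \<open>X\<close> embeds, isometrically up to a scalar, into a module
  whose action and coaction are adjoint, and inherits this property (\<open>act_adj\<close>). It follows that \<open>b\<close> is a
  self-adjoint projection that behaves like a conditional expectation onto a subalgebra; these
  projections are called biprojections.

  Second, the convolution \<open>m \<cdot> (b \<otimes> c) \<cdot> m\<^sup>\<dagger>\<close> of two biprojections is a multiple of the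
  projection \<open>p\<close> onto the product of the two subalgebras, and
  \<open>tr (b \<cdot> c) * tr p = tr b * tr c\<close> (\<open>join_projection\<close>). For subgroups \<open>H\<close> and \<open>K\<close> of a
  finite group this is the formula \<open>|H \<inter> K| * |H K| = |H| * |K|\<close>.

  Third, the traces of nonzero projections on \<open>X\<close> are bounded below by a constant \<open>\<kappa> > 0\<close>
  (\<open>projection_trace_bound\<close>): the zigzag identity writes \<open>q\<close> as a composite whose norm is
  controlled by \<open>tr q\<close>, and nonzero projections have norm 1. If \<open>b \<noteq> c\<close>, then \<open>p\<close> differs from one
  of them and its trace exceeds the trace of that one by \<open>\<kappa>\<close>. Inserted into
  \<open>\<parallel>b - c\<parallel>\<^sup>2 = tr b + tr c - 2 tr (b \<cdot> c)\<close> this bounds the distance of \<open>b\<close> and \<open>c\<close> from below.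
\<close>

section \<open>Diagrammatic calculus\<close>

text \<open>
  A strict tensor category with dagger in one-sorted style. An arrow knows its source and
  target, so that the side conditions of the categorical laws are equations between objects which the
  simplifier decides, and diagrammatic proofs become chains of rewriting steps. Of the linear structure only the
  scalars are kept; \<open>0 \<odot> f\<close> is the zero arrow parallel to \<open>f\<close>.
\<close>

locale dagger_tensor_calculus =
  fixes arr :: "'a \<Rightarrow> bool" and dom cod :: "'a \<Rightarrow> 'o"
    and uobj :: 'o and tob :: "'o \<Rightarrow> 'o \<Rightarrow> 'o" (infixr "\<diamondop>" 75)
    and idn :: "'o \<Rightarrow> 'a" ("\<one>")
    and cmp :: "'a \<Rightarrow> 'a \<Rightarrow> 'a" (infixr "\<bullet>" 70)
    and tns :: "'a \<Rightarrow> 'a \<Rightarrow> 'a" (infixr "\<star>" 75)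
    and adj :: "'a \<Rightarrow> 'a" ("_\<dagger>" [1000] 1000)
    and scale :: "complex \<Rightarrow> 'a \<Rightarrow> 'a" (infixr "\<odot>" 72)
  assumes tob_assoc [simp]: "(A \<diamondop> B) \<diamondop> D = A \<diamondop> (B \<diamondop> D)"
    and tob_unit [simp]: "uobj \<diamondop> A = A" "A \<diamondop> uobj = A"
    and arr_simps [simp]: "arr (\<one> A)" "arr f \<Longrightarrow> arr (f\<dagger>)" "arr f \<Longrightarrow> arr (z \<odot> f)"
      "\<lbrakk>arr f; arr g; dom g = cod f\<rbrakk> \<Longrightarrow> arr (g \<bullet> f)" "\<lbrakk>arr f; arr g\<rbrakk> \<Longrightarrow> arr (f \<star> g)"
    and dom_simps [simp]: "dom (\<one> A) = A" "dom (f\<dagger>) = cod f" "dom (z \<odot> f) = dom f"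
      "dom (g \<bullet> f) = dom f" "dom (f \<star> g) = dom f \<diamondop> dom g"
    and cod_simps [simp]: "cod (\<one> A) = A" "cod (f\<dagger>) = dom f" "cod (z \<odot> f) = cod f"
      "cod (g \<bullet> f) = cod g" "cod (f \<star> g) = cod f \<diamondop> cod g"
    and cmp_idn [simp]: "\<lbrakk>arr f; dom f = A\<rbrakk> \<Longrightarrow> f \<bullet> \<one> A = f"
    and idn_cmp [simp]: "\<lbrakk>arr f; cod f = A\<rbrakk> \<Longrightarrow> \<one> A \<bullet> f = f"
    and cmp_assoc [simp]: "\<lbrakk>arr f; arr g; arr h; dom g = cod f; dom h = cod g\<rbrakk>
      \<Longrightarrow> (h \<bullet> g) \<bullet> f = h \<bullet> (g \<bullet> f)"
    and tns_idn [simp]: "\<one> A \<star> \<one> B = \<one> (A \<diamondop> B)"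
    and tns_cmp: "\<lbrakk>arr f; arr f'; arr g; arr g'; dom f' = cod f; dom g' = cod g\<rbrakk>
      \<Longrightarrow> (f' \<star> g') \<bullet> (f \<star> g) = (f' \<bullet> f) \<star> (g' \<bullet> g)"
    and tns_assoc [simp]: "\<lbrakk>arr f; arr g; arr h\<rbrakk> \<Longrightarrow> (f \<star> g) \<star> h = f \<star> (g \<star> h)"
    and tns_unit [simp]: "arr f \<Longrightarrow> \<one> uobj \<star> f = f" "arr f \<Longrightarrow> f \<star> \<one> uobj = f"
    and adj_adj [simp]: "arr f \<Longrightarrow> f\<dagger>\<dagger> = f"
    and adj_idn [simp]: "(\<one> A)\<dagger> = \<one> A"
    and adj_cmp [simp]: "\<lbrakk>arr f; arr g; dom g = cod f\<rbrakk> \<Longrightarrow> (g \<bullet> f)\<dagger> = f\<dagger> \<bullet> g\<dagger>"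
    and adj_tns [simp]: "\<lbrakk>arr f; arr g\<rbrakk> \<Longrightarrow> (f \<star> g)\<dagger> = f\<dagger> \<star> g\<dagger>"
    and adj_scale [simp]: "arr f \<Longrightarrow> (z \<odot> f)\<dagger> = cnj z \<odot> f\<dagger>"
    and scale_scale [simp]: "z \<odot> w \<odot> f = (z * w) \<odot> f"
    and scale_one [simp]: "1 \<odot> f = f"
    and scale_cmp [simp]: "\<lbrakk>arr f; arr g; dom g = cod f\<rbrakk> \<Longrightarrow> (z \<odot> g) \<bullet> f = z \<odot> (g \<bullet> f)"
      "\<lbrakk>arr f; arr g; dom g = cod f\<rbrakk> \<Longrightarrow> g \<bullet> (z \<odot> f) = z \<odot> (g \<bullet> f)"
    and scale_tns [simp]: "\<lbrakk>arr f; arr g\<rbrakk> \<Longrightarrow> (z \<odot> f) \<star> g = z \<odot> (f \<star> g)"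
      "\<lbrakk>arr f; arr g\<rbrakk> \<Longrightarrow> f \<star> (z \<odot> g) = z \<odot> (f \<star> g)"
    and adj_definite: "\<lbrakk>arr f; f\<dagger> \<bullet> f = 0 \<odot> \<one> (dom f)\<rbrakk> \<Longrightarrow> f = 0 \<odot> f"
begin

text \<open>
  Reversing the tensor product, which reflects string diagrams in a vertical axis, again gives such a category.
  Every statement about left actions thereby yields its counterpart for right actions.
\<close>

lemma mirror:
  "dagger_tensor_calculus arr dom cod uobj (\<lambda>A B. B \<diamondop> A) \<one> (\<bullet>) (\<lambda>f g. g \<star> f) adj (\<odot>)"
  by unfold_locales (simp_all add: tns_cmp adj_definite)

lemma idn_tns_idn_tns [simp]: "arr f \<Longrightarrow> \<one> A \<star> \<one> B \<star> f = \<one> (A \<diamondop> B) \<star> f"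
  using tns_assoc[of "\<one> A" "\<one> B" f] by simp

lemma whisker_cmp:
  assumes "arr f" "arr g" "dom g = cod f"
  shows "\<one> A \<star> (g \<bullet> f) = (\<one> A \<star> g) \<bullet> (\<one> A \<star> f)"
    and "(g \<bullet> f) \<star> \<one> A = (g \<star> \<one> A) \<bullet> (f \<star> \<one> A)"
  using assms by (simp_all add: tns_cmp)

lemma interchange:
  assumes "arr f" "arr g"
  shows "(f \<star> \<one> (cod g)) \<bullet> (\<one> (dom f) \<star> g) = (\<one> (cod f) \<star> g) \<bullet> (f \<star> \<one> (dom g))"
  using assms by (simp add: tns_cmp)

end

section \<open>Unitary Frobenius algebras and biprojections\<close>

locale unitary_frobenius_object = dagger_tensor_calculus +
  fixes X :: 'o and m e :: 'a
  assumes m [simp]: "arr m" "dom m = X \<diamondop> X" "cod m = X"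
    and e [simp]: "arr e" "dom e = uobj" "cod e = X"
    and assoc: "m \<bullet> (m \<star> \<one> X) = m \<bullet> (\<one> X \<star> m)"
    and unit_left: "m \<bullet> (e \<star> \<one> X) = \<one> X"
    and unit_right: "m \<bullet> (\<one> X \<star> e) = \<one> X"
    and frobenius_left: "(\<one> X \<star> m) \<bullet> (m\<dagger> \<star> \<one> X) = m\<dagger> \<bullet> m"
    and frobenius_right: "(m \<star> \<one> X) \<bullet> (\<one> X \<star> m\<dagger>) = m\<dagger> \<bullet> m"
begin

abbreviation coev where "coev \<equiv> m\<dagger> \<bullet> e"
abbreviation ev where "ev \<equiv> e\<dagger> \<bullet> m"

lemma mirror_frobenius:
  "unitary_frobenius_object arr dom cod uobj (\<lambda>A B. B \<diamondop> A) \<one> (\<bullet>) (\<lambda>f g. g \<star> f) adj (\<odot>) X m e"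
  by (intro unitary_frobenius_object.intro unitary_frobenius_object_axioms.intro mirror)
    (simp_all add: assoc unit_left unit_right frobenius_left frobenius_right)

lemma counit_left: "(e\<dagger> \<star> \<one> X) \<bullet> m\<dagger> = \<one> X"
  using arg_cong[OF unit_left, of adj] by simp

lemma counit_right: "(\<one> X \<star> e\<dagger>) \<bullet> m\<dagger> = \<one> X"
  using arg_cong[OF unit_right, of adj] by simp

lemma coassoc: "(m\<dagger> \<star> \<one> X) \<bullet> m\<dagger> = (\<one> X \<star> m\<dagger>) \<bullet> m\<dagger>"
  using arg_cong[OF assoc, of adj] by simp

text \<open>
  The comultiplication is recovered from the multiplication and the selfduality, by bending one leg of
  \<open>m\<close>.
\<close>

lemma comult_via_coev: "(\<one> X \<star> m) \<bullet> (coev \<star> \<one> X) = m\<dagger>"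
proof -
  have "(\<one> X \<star> m) \<bullet> (coev \<star> \<one> X) = ((\<one> X \<star> m) \<bullet> (m\<dagger> \<star> \<one> X)) \<bullet> (e \<star> \<one> X)"
    by (simp add: whisker_cmp)
  also have "\<dots> = m\<dagger>"
    unfolding frobenius_left by (simp add: unit_left)
  finally show ?thesis .
qed

lemma comult_via_coev': "(m \<star> \<one> X) \<bullet> (\<one> X \<star> coev) = m\<dagger>"
  by (rule unitary_frobenius_object.comult_via_coev[OF mirror_frobenius])

lemma mult_via_ev: "(ev \<star> \<one> X) \<bullet> (\<one> X \<star> m\<dagger>) = m"
proof -
  have "(ev \<star> \<one> X) \<bullet> (\<one> X \<star> m\<dagger>) = (e\<dagger> \<star> \<one> X) \<bullet> ((m \<star> \<one> X) \<bullet> (\<one> X \<star> m\<dagger>))"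
    by (simp add: whisker_cmp)
  also have "\<dots> = ((e\<dagger> \<star> \<one> X) \<bullet> m\<dagger>) \<bullet> m"
    unfolding frobenius_right by simp
  finally show ?thesis
    by (simp add: counit_left)
qed

end

locale connected_frobenius_object = unitary_frobenius_object +
  assumes unit_nonzero: "e \<noteq> 0 \<odot> e"
    and unit_spans: "\<lbrakk>arr f; dom f = uobj; cod f = X\<rbrakk> \<Longrightarrow> \<exists>z. f = z \<odot> e"
begin

lemma mirror_connected:
  "connected_frobenius_object arr dom cod uobj (\<lambda>A B. B \<diamondop> A) \<one> (\<bullet>) (\<lambda>f g. g \<star> f) adj (\<odot>) X m e"
  by (intro connected_frobenius_object.intro connected_frobenius_object_axioms.intro mirror_frobenius
      unit_nonzero unit_spans)

text \<open>
  A right \<open>X\<close>-linear endomorphism of \<open>X\<close> is multiplication by its value at the unit, an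
  element of the one-dimensional space of arrows from the tensor unit to \<open>X\<close>. Connectedness
  is mostly used in this form.
\<close>

lemma right_linear_scalar:
  assumes "arr h" "dom h = X" "cod h = X" "h \<bullet> m = m \<bullet> (h \<star> \<one> X)"
  shows "\<exists>z. h = z \<odot> \<one> X"
proof -
  obtain z where z: "h \<bullet> e = z \<odot> e"
    using unit_spans[of "h \<bullet> e"] assms by auto
  have "h = (h \<bullet> m) \<bullet> (e \<star> \<one> X)"
    using assms(1-3) by (simp add: unit_left)
  also have "\<dots> = m \<bullet> ((h \<bullet> e) \<star> \<one> X)"
    unfolding assms(4) using assms(1-3) by (simp add: whisker_cmp)
  also have "\<dots> = z \<odot> \<one> X"
    by (simp add: z unit_left)
  finally show ?thesis ..
qed

text \<open>
  These are the conditional expectations of \<open>X\<close> onto subalgebras. The last two conditions are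
  the bimodule properties \<open>b (a x) = a (b x)\<close> and \<open>b (x a) = (b x) a\<close> for \<open>a\<close> in the range
  of \<open>b\<close>.
\<close>

definition biprojection :: "'a \<Rightarrow> bool" where
  "biprojection b \<longleftrightarrow> arr b \<and> dom b = X \<and> cod b = X \<and> b\<dagger> = b \<and> b \<bullet> b = b \<and> b \<bullet> e = e \<and>
     b \<bullet> m \<bullet> (b \<star> \<one> X) = m \<bullet> (b \<star> b) \<and> b \<bullet> m \<bullet> (\<one> X \<star> b) = m \<bullet> (b \<star> b)"

lemma biprojectionD:
  assumes "biprojection b"
  shows biprojection_simps [simp]: "arr b" "dom b = X" "cod b = X" "b\<dagger> = b" "b \<bullet> b = b" "b \<bullet> e = e"
    and "b \<bullet> m \<bullet> (b \<star> \<one> X) = m \<bullet> (b \<star> b)" "b \<bullet> m \<bullet> (\<one> X \<star> b) = m \<bullet> (b \<star> b)"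
  using assms by (auto simp: biprojection_def)

lemma mirror_biprojection:
  "connected_frobenius_object.biprojection arr dom cod \<one> (\<bullet>) (\<lambda>f g. g \<star> f) adj X m e b \<longleftrightarrow> biprojection b"
  unfolding biprojection_def connected_frobenius_object.biprojection_def[OF mirror_connected] by auto

end

section \<open>Algebra homomorphisms into a connected Frobenius algebra\<close>

locale frobenius_algebra_hom = dagger_tensor_calculus +
  A: unitary_frobenius_object _ _ _ _ _ _ _ _ _ _ A m\<^sub>A e\<^sub>A +
  X: connected_frobenius_object _ _ _ _ _ _ _ _ _ _ X m e
  for A m\<^sub>A e\<^sub>A X m e +
  fixes i :: 'a
  assumes i [simp]: "arr i" "dom i = A" "cod i = X"
    and hom_mult: "i \<bullet> m\<^sub>A = m \<bullet> (i \<star> i)"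
    and hom_unit: "i \<bullet> e\<^sub>A = e"
begin

lemma mirror_hom:
  "frobenius_algebra_hom arr dom cod uobj (\<lambda>A B. B \<diamondop> A) \<one> (\<bullet>) (\<lambda>f g. g \<star> f) adj (\<odot>) A m\<^sub>A e\<^sub>A X m e i"
  by (intro frobenius_algebra_hom.intro frobenius_algebra_hom_axioms.intro
      mirror A.mirror_frobenius X.mirror_connected) (simp_all add: hom_mult hom_unit)

text \<open>
  The action of \<open>A\<close> on \<open>X\<close> through \<open>i\<close>, and the same action with its leg \<open>A\<close>
  bent to the other side.
\<close>

definition act where "act = m \<bullet> (i \<star> \<one> X)"
definition coact where "coact = (\<one> A \<star> act) \<bullet> (A.coev \<star> \<one> X)"

lemma act_simps [simp]: "arr act" "dom act = A \<diamondop> X" "cod act = X"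
  by (simp_all add: act_def)

lemma coact_simps [simp]: "arr coact" "dom coact = X" "cod coact = A \<diamondop> X"
  by (simp_all add: coact_def)

lemma act_right_linear: "act \<bullet> (\<one> A \<star> m) = m \<bullet> (act \<star> \<one> X)"
proof -
  have "act \<bullet> (\<one> A \<star> m) = m \<bullet> (\<one> X \<star> m) \<bullet> (i \<star> \<one> (X \<diamondop> X))"
    using interchange[of i m] by (simp add: act_def)
  also have "\<dots> = (m \<bullet> (m \<star> \<one> X)) \<bullet> (i \<star> \<one> (X \<diamondop> X))"
    unfolding X.assoc by simp
  also have "\<dots> = m \<bullet> (act \<star> \<one> X)"
    by (simp add: act_def whisker_cmp)
  finally show ?thesis .
qed

lemma act_act: "act \<bullet> (\<one> A \<star> act) = act \<bullet> (m\<^sub>A \<star> \<one> X)"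
proof -
  have "act \<bullet> (\<one> A \<star> act) = (act \<bullet> (\<one> A \<star> m)) \<bullet> (\<one> A \<star> i \<star> \<one> X)"
    by (simp add: act_def whisker_cmp)
  also have "\<dots> = m \<bullet> ((act \<bullet> (\<one> A \<star> i)) \<star> \<one> X)"
    unfolding act_right_linear by (simp add: whisker_cmp)
  also have "act \<bullet> (\<one> A \<star> i) = i \<bullet> m\<^sub>A"
    by (simp add: act_def tns_cmp hom_mult)
  also have "m \<bullet> ((i \<bullet> m\<^sub>A) \<star> \<one> X) = act \<bullet> (m\<^sub>A \<star> \<one> X)"
    by (simp add: act_def whisker_cmp)
  finally show ?thesis .
qed

lemma act_unit: "act \<bullet> (e\<^sub>A \<star> \<one> X) = \<one> X"
  by (simp add: act_def X.unit_left hom_unit flip: whisker_cmp)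

lemma coact_counit: "(e\<^sub>A\<dagger> \<star> \<one> X) \<bullet> coact = \<one> X"
proof -
  have "(e\<^sub>A\<dagger> \<star> \<one> X) \<bullet> coact = act \<bullet> ((e\<^sub>A\<dagger> \<star> \<one> (A \<diamondop> X)) \<bullet> (A.coev \<star> \<one> X))"
    using interchange[of "e\<^sub>A\<dagger>" act]
    by (simp add: coact_def flip: cmp_assoc)
  also have "(e\<^sub>A\<dagger> \<star> \<one> (A \<diamondop> X)) \<bullet> (A.coev \<star> \<one> X) = (((e\<^sub>A\<dagger> \<star> \<one> A) \<bullet> m\<^sub>A\<dagger>) \<bullet> e\<^sub>A) \<star> \<one> X"
    by (simp add: whisker_cmp)
  finally show ?thesis
    by (simp add: A.counit_left act_unit)
qed

lemma coact_right_linear: "coact \<bullet> m = (\<one> A \<star> m) \<bullet> (coact \<star> \<one> X)"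
proof -
  have "coact \<bullet> m = (\<one> A \<star> (act \<bullet> (\<one> A \<star> m))) \<bullet> (A.coev \<star> \<one> (X \<diamondop> X))"
    using interchange[of A.coev m] by (simp add: coact_def whisker_cmp)
  also have "\<dots> = (\<one> A \<star> m) \<bullet> (coact \<star> \<one> X)"
    unfolding act_right_linear by (simp add: coact_def whisker_cmp)
  finally show ?thesis .
qed

lemma act_adj_right_linear: "act\<dagger> \<bullet> m = (\<one> A \<star> m) \<bullet> (act\<dagger> \<star> \<one> X)"
proof -
  have "act\<dagger> \<bullet> m = (i\<dagger> \<star> \<one> X) \<bullet> (\<one> X \<star> m) \<bullet> (m\<dagger> \<star> \<one> X)"
    by (simp add: act_def X.frobenius_left)
  also have "\<dots> = (\<one> A \<star> m) \<bullet> (act\<dagger> \<star> \<one> X)"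
    using interchange[of "i\<dagger>" m] by (simp add: act_def whisker_cmp flip: cmp_assoc)
  finally show ?thesis .
qed

lemma coact_adj_right_linear: "coact\<dagger> \<bullet> (\<one> A \<star> m) = m \<bullet> (coact\<dagger> \<star> \<one> X)"
proof -
  have "coact\<dagger> \<bullet> (\<one> A \<star> m) = (A.ev \<star> \<one> X) \<bullet> (\<one> A \<star> (act\<dagger> \<bullet> m))"
    by (simp add: coact_def whisker_cmp)
  also have "\<dots> = ((A.ev \<star> \<one> X) \<bullet> (\<one> (A \<diamondop> A) \<star> m)) \<bullet> (\<one> A \<star> act\<dagger> \<star> \<one> X)"
    unfolding act_adj_right_linear by (simp add: whisker_cmp)
  also have "\<dots> = m \<bullet> (coact\<dagger> \<star> \<one> X)"
    using interchange[of A.ev m] by (simp add: coact_def whisker_cmp)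
  finally show ?thesis .
qed

text \<open>
  The coaction is left \<open>A\<close>-linear: both sides bring a factor of \<open>A\<close> past the
  coevaluation, where the two ways of bending \<open>m\<^sub>A\<close> agree.
\<close>

lemma coact_act: "coact \<bullet> act = (m\<^sub>A \<star> \<one> X) \<bullet> (\<one> A \<star> coact)"
proof -
  have "coact \<bullet> act = (\<one> A \<star> (act \<bullet> (\<one> A \<star> act))) \<bullet> (A.coev \<star> \<one> (A \<diamondop> X))"
    using interchange[of A.coev act] by (simp add: coact_def whisker_cmp)
  also have "\<dots> = (\<one> A \<star> act) \<bullet> (((\<one> A \<star> m\<^sub>A) \<bullet> (A.coev \<star> \<one> A)) \<star> \<one> X)"
    unfolding act_act by (simp add: whisker_cmp)
  also have "\<dots> = (\<one> A \<star> act) \<bullet> (((m\<^sub>A \<star> \<one> A) \<bullet> (\<one> A \<star> A.coev)) \<star> \<one> X)"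
    unfolding A.comult_via_coev A.comult_via_coev' ..
  also have "\<dots> = (m\<^sub>A \<star> \<one> X) \<bullet> (\<one> A \<star> coact)"
    using interchange[of m\<^sub>A act] by (simp add: coact_def whisker_cmp flip: cmp_assoc)
  finally show ?thesis .
qed

text \<open>
  By linearity over \<open>X\<close> and connectedness, \<open>coact\<dagger> \<bullet> coact\<close> is a scalar \<open>k\<close>. Hence
  \<open>coact\<close> identifies \<open>X\<close>, up to \<open>k\<close>, with a submodule of the free module \<open>A \<otimes> X\<close>, for
  which action and coaction are adjoint because \<open>m\<^sub>A\<dagger>\<close> is the comultiplication of \<open>A\<close>.
  Compressing this relation to \<open>X\<close> gives the claim.
\<close>

lemma act_adj: "act\<dagger> = coact"
proof -
  have "(coact\<dagger> \<bullet> coact) \<bullet> m = (coact\<dagger> \<bullet> (\<one> A \<star> m)) \<bullet> (coact \<star> \<one> X)"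
    by (simp add: coact_right_linear)
  also have "\<dots> = m \<bullet> ((coact\<dagger> \<bullet> coact) \<star> \<one> X)"
    unfolding coact_adj_right_linear by (simp add: whisker_cmp)
  finally obtain k where k: "coact\<dagger> \<bullet> coact = k \<odot> \<one> X"
    using X.right_linear_scalar[of "coact\<dagger> \<bullet> coact"] by auto
  have k_real: "cnj k \<odot> \<one> X = k \<odot> \<one> X"
  proof -
    have "(coact\<dagger> \<bullet> coact)\<dagger> = coact\<dagger> \<bullet> coact"
      by simp
    then show ?thesis
      unfolding k by simp
  qed
  \<comment> \<open>Otherwise \<open>coact\<close> vanishes by definiteness, although the counit of \<open>A\<close> is a left inverse of it.\<close>
  have "k \<noteq> 0"
  proof
    assume "k = 0"
    then have "coact = 0 \<odot> coact"
      using adj_definite[of coact] k by simp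
    then have "\<one> X = 0 \<odot> \<one> X"
      using coact_counit scale_cmp(2)[of coact "e\<^sub>A\<dagger> \<star> \<one> X" 0] by simp
    then show False
      using X.unit_nonzero scale_cmp(1)[of e "\<one> X" 0] by simp
  qed
  \<comment> \<open>The action on \<open>X\<close> is the compression of the free action, \<open>k act = coact\<dagger> (m\<^sub>A \<star> 1) (1 \<star> coact)\<close>; take adjoints.\<close>
  have "k \<odot> act = (coact\<dagger> \<bullet> coact) \<bullet> act"
    by (simp add: k)
  also have "\<dots> = coact\<dagger> \<bullet> (m\<^sub>A \<star> \<one> X) \<bullet> (\<one> A \<star> coact)"
    by (simp add: coact_act)
  finally have k_act: "k \<odot> act = coact\<dagger> \<bullet> (m\<^sub>A \<star> \<one> X) \<bullet> (\<one> A \<star> coact)" .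
  have "cnj k \<odot> act\<dagger> = (k \<odot> act)\<dagger>"
    by simp
  also have "\<dots> = (\<one> A \<star> coact\<dagger>) \<bullet> (m\<^sub>A\<dagger> \<star> \<one> X) \<bullet> coact"
    unfolding k_act by simp
  also have "(m\<^sub>A\<dagger> \<star> \<one> X) \<bullet> coact = (\<one> A \<star> ((m\<^sub>A \<star> \<one> X) \<bullet> (\<one> A \<star> coact))) \<bullet> (A.coev \<star> \<one> X)"
  proof -
    have "(m\<^sub>A\<dagger> \<star> \<one> X) \<bullet> coact = (((\<one> A \<star> m\<^sub>A) \<bullet> (A.coev \<star> \<one> A)) \<star> \<one> X) \<bullet> coact"
      unfolding A.comult_via_coev ..
    also have "\<dots> = (\<one> A \<star> m\<^sub>A \<star> \<one> X) \<bullet> (A.coev \<star> \<one> (A \<diamondop> X)) \<bullet> coact"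
      by (simp add: whisker_cmp)
    also have "\<dots> = (\<one> A \<star> ((m\<^sub>A \<star> \<one> X) \<bullet> (\<one> A \<star> coact))) \<bullet> (A.coev \<star> \<one> X)"
      using interchange[of A.coev coact] by (simp add: whisker_cmp flip: cmp_assoc)
    finally show ?thesis .
  qed
  also have "(\<one> A \<star> coact\<dagger>) \<bullet> \<dots> = (\<one> A \<star> ((coact\<dagger> \<bullet> coact) \<bullet> act)) \<bullet> (A.coev \<star> \<one> X)"
    by (simp add: whisker_cmp flip: coact_act)
  also have "\<dots> = k \<odot> coact"
    unfolding k by (simp add: coact_def)
  finally have "cnj k \<odot> act\<dagger> = k \<odot> coact" .
  moreover have "cnj k \<odot> act\<dagger> = k \<odot> act\<dagger>"
    using arg_cong[OF k_real, of "\<lambda>f. act\<dagger> \<bullet> f"] by simp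
  ultimately have "k \<odot> act\<dagger> = k \<odot> coact"
    by simp
  then have "inverse k \<odot> k \<odot> act\<dagger> = inverse k \<odot> k \<odot> coact"
    by (rule arg_cong)
  with \<open>k \<noteq> 0\<close> show ?thesis
    by simp
qed

text \<open>
  The transpose for the Frobenius selfdualities is obtained from the right-handed version of
  \<open>act_adj\<close> by closing the leg \<open>X\<close> with the counit.
\<close>

lemma adj_eq_transpose: "(X.ev \<star> \<one> A) \<bullet> (\<one> X \<star> i \<star> \<one> A) \<bullet> (\<one> X \<star> A.coev) = i\<dagger>"
proof -
  have "(\<one> X \<star> i\<dagger>) \<bullet> m\<dagger> = ((m \<bullet> (\<one> X \<star> i)) \<star> \<one> A) \<bullet> (\<one> X \<star> A.coev)"
    using frobenius_algebra_hom.act_adj[OF mirror_hom]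
    unfolding frobenius_algebra_hom.act_def[OF mirror_hom] frobenius_algebra_hom.coact_def[OF mirror_hom]
    by simp
  then have "(e\<dagger> \<star> \<one> A) \<bullet> (\<one> X \<star> i\<dagger>) \<bullet> m\<dagger>
      = (X.ev \<star> \<one> A) \<bullet> (\<one> X \<star> i \<star> \<one> A) \<bullet> (\<one> X \<star> A.coev)"
    by (simp add: whisker_cmp)
  moreover have "(e\<dagger> \<star> \<one> A) \<bullet> (\<one> X \<star> i\<dagger>) \<bullet> m\<dagger> = i\<dagger> \<bullet> (e\<dagger> \<star> \<one> X) \<bullet> m\<dagger>"
    using interchange[of "e\<dagger>" "i\<dagger>"] by (simp flip: cmp_assoc)
  ultimately show ?thesis
    by (simp add: X.counit_left)
qed

text \<open>
  The adjoint of \<open>i\<close> is a module map: write the action as the adjoint of the coaction, so that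
  \<open>i\<dagger>\<close> meets \<open>m\<dagger>\<close>, and use that \<open>i\<dagger>\<close> is a map of coalgebras because \<open>i\<close> is one of
  algebras.
\<close>

lemma adj_act: "i\<dagger> \<bullet> act = m\<^sub>A \<bullet> (\<one> A \<star> i\<dagger>)"
proof -
  have hom_comult: "m\<^sub>A\<dagger> \<bullet> i\<dagger> = (i\<dagger> \<star> i\<dagger>) \<bullet> m\<dagger>"
    using arg_cong[OF hom_mult, of adj] by simp
  have "act = (A.ev \<star> \<one> X) \<bullet> (\<one> A \<star> (act\<dagger>))"
    using arg_cong[OF act_adj, of adj] by (simp add: coact_def)
  then have "i\<dagger> \<bullet> act = (i\<dagger> \<bullet> (A.ev \<star> \<one> X)) \<bullet> (\<one> A \<star> (i\<dagger> \<star> \<one> X)) \<bullet> (\<one> A \<star> m\<dagger>)"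
    by (simp add: act_def whisker_cmp)
  also have "i\<dagger> \<bullet> (A.ev \<star> \<one> X) = (A.ev \<star> \<one> A) \<bullet> (\<one> (A \<diamondop> A) \<star> i\<dagger>)"
    using interchange[of A.ev "i\<dagger>"] by simp
  also have "((A.ev \<star> \<one> A) \<bullet> (\<one> (A \<diamondop> A) \<star> i\<dagger>)) \<bullet> (\<one> A \<star> (i\<dagger> \<star> \<one> X)) \<bullet> (\<one> A \<star> m\<dagger>)
      = (A.ev \<star> \<one> A) \<bullet> (\<one> A \<star> (((\<one> A \<star> i\<dagger>) \<bullet> (i\<dagger> \<star> \<one> X)) \<bullet> m\<dagger>))"
    by (simp add: whisker_cmp)
  also have "\<dots> = (A.ev \<star> \<one> A) \<bullet> (\<one> A \<star> (m\<^sub>A\<dagger> \<bullet> i\<dagger>))"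
    unfolding hom_comult by (simp add: tns_cmp)
  also have "\<dots> = ((A.ev \<star> \<one> A) \<bullet> (\<one> A \<star> m\<^sub>A\<dagger>)) \<bullet> (\<one> A \<star> i\<dagger>)"
    by (simp add: whisker_cmp)
  also have "\<dots> = m\<^sub>A \<bullet> (\<one> A \<star> i\<dagger>)"
    unfolding A.mult_via_ev ..
  finally show ?thesis .
qed

lemma left_expectation:
  "i \<bullet> i\<dagger> \<bullet> m \<bullet> ((i \<bullet> i\<dagger>) \<star> \<one> X) = m \<bullet> ((i \<bullet> i\<dagger>) \<star> (i \<bullet> i\<dagger>))"
proof -
  have "i \<bullet> i\<dagger> \<bullet> m \<bullet> ((i \<bullet> i\<dagger>) \<star> \<one> X) = i \<bullet> (i\<dagger> \<bullet> act) \<bullet> (i\<dagger> \<star> \<one> X)"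
    by (simp add: act_def whisker_cmp)
  also have "\<dots> = (i \<bullet> m\<^sub>A) \<bullet> ((\<one> A \<star> i\<dagger>) \<bullet> (i\<dagger> \<star> \<one> X))"
    unfolding adj_act by simp
  also have "\<dots> = m \<bullet> ((i \<bullet> i\<dagger>) \<star> (i \<bullet> i\<dagger>))"
    unfolding hom_mult by (simp add: tns_cmp)
  finally show ?thesis .
qed

lemma right_expectation:
  "i \<bullet> i\<dagger> \<bullet> m \<bullet> (\<one> X \<star> (i \<bullet> i\<dagger>)) = m \<bullet> ((i \<bullet> i\<dagger>) \<star> (i \<bullet> i\<dagger>))"
  by (rule frobenius_algebra_hom.left_expectation[OF mirror_hom])

lemma biprojection_range:
  assumes "i\<dagger> \<bullet> i = \<one> A"
  shows "X.biprojection (i \<bullet> i\<dagger>)"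
  unfolding X.biprojection_def
proof (intro conjI)
  have "(i \<bullet> i\<dagger>) \<bullet> (i \<bullet> i\<dagger>) = i \<bullet> (i\<dagger> \<bullet> i) \<bullet> i\<dagger>"
    by simp
  then show "(i \<bullet> i\<dagger>) \<bullet> (i \<bullet> i\<dagger>) = i \<bullet> i\<dagger>"
    unfolding assms by simp
  have "(i \<bullet> i\<dagger>) \<bullet> e = i \<bullet> (i\<dagger> \<bullet> i) \<bullet> e\<^sub>A"
    unfolding hom_unit[symmetric] by simp
  then show "(i \<bullet> i\<dagger>) \<bullet> e = e"
    unfolding assms by (simp add: hom_unit)
qed (use left_expectation right_expectation in simp_all)

end

section \<open>Convolution of biprojections\<close>

context connected_frobenius_object
begin

text \<open>
  The convolution of endomorphisms of \<open>X\<close>, which corresponds to the composition of bimodule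
  endomorphisms of \<open>X \<otimes> X\<close>. For biprojections its range is the product of the two subalgebras.
\<close>

definition conv :: "'a \<Rightarrow> 'a \<Rightarrow> 'a" (infixr "\<circledast>" 72) where
  "a \<circledast> b = m \<bullet> (a \<star> b) \<bullet> m\<dagger>"

lemma conv_simps [simp]:
  assumes "arr a" "dom a = X" "cod a = X" "arr b" "dom b = X" "cod b = X"
  shows "arr (a \<circledast> b)" "dom (a \<circledast> b) = X" "cod (a \<circledast> b) = X"
    "(a \<circledast> b)\<dagger> = a\<dagger> \<circledast> b\<dagger>"
  using assms by (simp_all add: conv_def)

definition closure :: "'a \<Rightarrow> 'a" where
  "closure f = ev \<bullet> (f \<star> \<one> X) \<bullet> coev"

lemma coev_biprojection:
  assumes [simp]: "biprojection b"
  shows "(b \<star> \<one> X) \<bullet> coev = (b \<star> b) \<bullet> coev" "(\<one> X \<star> b) \<bullet> coev = (b \<star> b) \<bullet> coev"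
  using arg_cong[OF biprojectionD(7)[OF assms], of "\<lambda>f. f\<dagger> \<bullet> e"]
    arg_cong[OF biprojectionD(8)[OF assms], of "\<lambda>f. f\<dagger> \<bullet> e"] by simp_all

text \<open>
  By the Frobenius relation an element of the range of \<open>b\<close> can be moved from the outside of the bubble
  onto its left edge, where the bimodule property lets it pass through \<open>b\<close>.
\<close>

lemma conv_left_linear:
  assumes [simp]: "biprojection b" "arr c" "dom c = X" "cod c = X"
  shows "(b \<circledast> c) \<bullet> m \<bullet> (b \<star> \<one> X) = m \<bullet> (b \<star> (b \<circledast> c))"
proof -
  have "(b \<circledast> c) \<bullet> m \<bullet> (b \<star> \<one> X) = m \<bullet> (b \<star> c) \<bullet> (m\<dagger> \<bullet> m) \<bullet> (b \<star> \<one> X)"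
    by (simp add: conv_def)
  also have "\<dots> = m \<bullet> (b \<star> c) \<bullet> (m \<star> \<one> X) \<bullet> ((\<one> X \<star> m\<dagger>) \<bullet> (b \<star> \<one> X))"
    unfolding frobenius_right[symmetric] by simp
  also have "(\<one> X \<star> m\<dagger>) \<bullet> (b \<star> \<one> X) = (b \<star> \<one> (X \<diamondop> X)) \<bullet> (\<one> X \<star> m\<dagger>)"
    by (simp add: tns_cmp)
  also have "m \<bullet> (b \<star> c) \<bullet> (m \<star> \<one> X) \<bullet> ((b \<star> \<one> (X \<diamondop> X)) \<bullet> (\<one> X \<star> m\<dagger>))
      = m \<bullet> ((b \<bullet> m \<bullet> (b \<star> \<one> X)) \<star> c) \<bullet> (\<one> X \<star> m\<dagger>)"
    using tns_cmp[of "b \<star> \<one> X" m "\<one> X" "\<one> X"] tns_cmp[of "m \<bullet> (b \<star> \<one> X)" b "\<one> X" c]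
    by (simp flip: cmp_assoc)
  also have "\<dots> = (m \<bullet> (m \<star> \<one> X)) \<bullet> (b \<star> b \<star> c) \<bullet> (\<one> X \<star> m\<dagger>)"
  proof -
    have "(b \<bullet> m \<bullet> (b \<star> \<one> X)) \<star> c = (m \<star> \<one> X) \<bullet> (b \<star> b \<star> c)"
      using tns_cmp[of "b \<star> b" m c "\<one> X"] by (simp add: biprojectionD(7))
    then show ?thesis
      by simp
  qed
  also have "\<dots> = m \<bullet> (\<one> X \<star> m) \<bullet> ((b \<star> b \<star> c) \<bullet> (\<one> X \<star> m\<dagger>))"
    unfolding assoc by simp
  also have "\<dots> = m \<bullet> (b \<star> (b \<circledast> c))"
    by (simp add: tns_cmp conv_def)
  finally show ?thesis .
qed

lemma conv_right_linear:
  assumes "biprojection b" "arr c" "dom c = X" "cod c = X"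
  shows "(c \<circledast> b) \<bullet> m \<bullet> (\<one> X \<star> b) = m \<bullet> ((c \<circledast> b) \<star> b)"
  using connected_frobenius_object.conv_left_linear[OF mirror_connected] assms mirror_biprojection
  unfolding connected_frobenius_object.conv_def[OF mirror_connected] conv_def by simp

lemma conv_id_scalar:
  assumes [simp]: "arr c" "dom c = X" "cod c = X"
  shows "\<exists>z. c \<circledast> \<one> X = z \<odot> \<one> X"
proof (rule right_linear_scalar)
  have "(c \<circledast> \<one> X) \<bullet> m = m \<bullet> (c \<star> \<one> X) \<bullet> (m\<dagger> \<bullet> m)"
    by (simp add: conv_def)
  also have "\<dots> = m \<bullet> ((c \<star> \<one> X) \<bullet> (\<one> X \<star> m)) \<bullet> (m\<dagger> \<star> \<one> X)"
    unfolding frobenius_left[symmetric] by simp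
  also have "(c \<star> \<one> X) \<bullet> (\<one> X \<star> m) = (\<one> X \<star> m) \<bullet> (c \<star> \<one> (X \<diamondop> X))"
    by (simp add: tns_cmp)
  also have "m \<bullet> ((\<one> X \<star> m) \<bullet> (c \<star> \<one> (X \<diamondop> X))) \<bullet> (m\<dagger> \<star> \<one> X)
      = (m \<bullet> (\<one> X \<star> m)) \<bullet> (c \<star> \<one> (X \<diamondop> X)) \<bullet> (m\<dagger> \<star> \<one> X)"
    by simp
  also have "\<dots> = m \<bullet> ((c \<circledast> \<one> X) \<star> \<one> X)"
    unfolding assoc[symmetric] by (simp add: conv_def whisker_cmp)
  finally show "(c \<circledast> \<one> X) \<bullet> m = m \<bullet> ((c \<circledast> \<one> X) \<star> \<one> X)" .
qed simp_all

text \<open>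
  Both closures are the theta graph with edges labelled \<open>b\<close>, \<open>c\<close> and the identity;
  associativity and coassociativity change which two of the edges form the inner bubble.
\<close>

lemma closure_conv:
  assumes [simp]: "arr b" "dom b = X" "cod b = X" "arr c" "dom c = X" "cod c = X"
  shows "closure (b \<circledast> c) = ev \<bullet> (b \<star> (c \<circledast> \<one> X)) \<bullet> coev"
proof -
  have "closure (b \<circledast> c) = e\<dagger> \<bullet> (m \<bullet> (m \<star> \<one> X)) \<bullet> (b \<star> c \<star> \<one> X) \<bullet> ((m\<dagger> \<star> \<one> X) \<bullet> m\<dagger>) \<bullet> e"
    by (simp add: closure_def conv_def whisker_cmp)
  also have "\<dots> = e\<dagger> \<bullet> m \<bullet> ((\<one> X \<star> m) \<bullet> (b \<star> c \<star> \<one> X) \<bullet> (\<one> X \<star> m\<dagger>)) \<bullet> m\<dagger> \<bullet> e"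
    unfolding assoc coassoc by simp
  also have "(\<one> X \<star> m) \<bullet> (b \<star> c \<star> \<one> X) \<bullet> (\<one> X \<star> m\<dagger>) = b \<star> (c \<circledast> \<one> X)"
    by (simp add: conv_def tns_cmp)
  finally show ?thesis
    by simp
qed

text \<open>
  The convolution \<open>F\<close> maps the unit to a multiple \<open>\<mu>\<close> of itself by connectedness. Being linear over
  the range of \<open>b\<close> on the left and over the range of \<open>c\<close> on the right, it is multiplication by
  \<open>\<mu>\<close> on the products of these ranges, and the range of \<open>F\<close> consists of such products. The
  factor \<open>\<nu>\<close> is the scalar of the right \<open>X\<close>-linear endomorphism \<open>c \<circledast> \<one> X\<close>.
\<close>

lemma conv_biprojections:
  assumes b [simp]: "biprojection b" and c [simp]: "biprojection c"
  obtains \<mu> \<nu> where "closure (b \<bullet> c) = \<mu> \<odot> (e\<dagger> \<bullet> e)" "closure c = \<nu> \<odot> (e\<dagger> \<bullet> e)"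
    "closure (b \<circledast> c) = \<nu> \<odot> closure b" "(b \<circledast> c) \<bullet> b = \<mu> \<odot> b" "(b \<circledast> c) \<bullet> c = \<mu> \<odot> c"
    "(b \<circledast> c) \<bullet> (b \<circledast> c) = \<mu> \<odot> (b \<circledast> c)"
proof -
  obtain \<mu> where \<mu>: "(b \<circledast> c) \<bullet> e = \<mu> \<odot> e"
    using unit_spans[of "(b \<circledast> c) \<bullet> e"] by auto
  obtain \<nu> where \<nu>: "c \<circledast> \<one> X = \<nu> \<odot> \<one> X"
    using conv_id_scalar[of c] by auto
  have unit_tns: "m \<bullet> (e \<star> f) = f" "m \<bullet> (f \<star> e) = f" if [simp]: "arr f" "dom f = X" "cod f = X" for f
    using arg_cong[OF unit_left, of "\<lambda>g. g \<bullet> f"] arg_cong[OF unit_right, of "\<lambda>g. g \<bullet> f"]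
      tns_cmp[of "\<one> uobj" e f "\<one> X"] tns_cmp[of f "\<one> X" "\<one> uobj" e] by simp_all
  have Fc: "(b \<circledast> c) \<bullet> c = \<mu> \<odot> c"
  proof -
    have "(b \<circledast> c) \<bullet> c = (b \<circledast> c) \<bullet> m \<bullet> ((\<one> X \<star> c) \<bullet> (e \<star> \<one> X))"
      by (simp add: tns_cmp unit_tns)
    also have "\<dots> = ((b \<circledast> c) \<bullet> m \<bullet> (\<one> X \<star> c)) \<bullet> (e \<star> \<one> X)"
      by simp
    also have "\<dots> = m \<bullet> (((b \<circledast> c) \<star> c) \<bullet> (e \<star> \<one> X))"
      by (simp add: conv_right_linear)
    also have "((b \<circledast> c) \<star> c) \<bullet> (e \<star> \<one> X) = \<mu> \<odot> (e \<star> c)"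
      by (simp add: tns_cmp \<mu>)
    finally show ?thesis
      by (simp add: unit_tns)
  qed
  have Fb: "(b \<circledast> c) \<bullet> b = \<mu> \<odot> b"
  proof -
    have "(b \<circledast> c) \<bullet> b = (b \<circledast> c) \<bullet> m \<bullet> ((b \<star> \<one> X) \<bullet> (\<one> X \<star> e))"
      by (simp add: tns_cmp unit_tns)
    also have "\<dots> = ((b \<circledast> c) \<bullet> m \<bullet> (b \<star> \<one> X)) \<bullet> (\<one> X \<star> e)"
      by simp
    also have "\<dots> = m \<bullet> ((b \<star> (b \<circledast> c)) \<bullet> (\<one> X \<star> e))"
      by (simp add: conv_left_linear)
    also have "(b \<star> (b \<circledast> c)) \<bullet> (\<one> X \<star> e) = \<mu> \<odot> (b \<star> e)"
      by (simp add: tns_cmp \<mu>)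
    finally show ?thesis
      by (simp add: unit_tns)
  qed
  have FF: "(b \<circledast> c) \<bullet> (b \<circledast> c) = \<mu> \<odot> (b \<circledast> c)"
  proof -
    have "(b \<circledast> c) \<bullet> (b \<circledast> c) = (b \<circledast> c) \<bullet> m \<bullet> ((b \<star> \<one> X) \<bullet> (\<one> X \<star> c)) \<bullet> m\<dagger>"
      unfolding conv_def[of b c] by (simp add: tns_cmp)
    also have "\<dots> = ((b \<circledast> c) \<bullet> m \<bullet> (b \<star> \<one> X)) \<bullet> (\<one> X \<star> c) \<bullet> m\<dagger>"
      by simp
    also have "\<dots> = m \<bullet> ((b \<star> (b \<circledast> c)) \<bullet> (\<one> X \<star> c)) \<bullet> m\<dagger>"
      by (simp add: conv_left_linear)
    also have "(b \<star> (b \<circledast> c)) \<bullet> (\<one> X \<star> c) = \<mu> \<odot> (b \<star> c)"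
      by (simp add: tns_cmp Fc)
    finally show ?thesis
      by (simp add: conv_def)
  qed
  have "closure (b \<bullet> c) = ev \<bullet> (b \<star> \<one> X) \<bullet> ((c \<star> \<one> X) \<bullet> coev)"
    by (simp add: closure_def whisker_cmp)
  also have "(c \<star> \<one> X) \<bullet> coev = (\<one> X \<star> c) \<bullet> coev"
    by (simp only: coev_biprojection[OF c])
  also have "ev \<bullet> (b \<star> \<one> X) \<bullet> ((\<one> X \<star> c) \<bullet> coev) = ev \<bullet> ((b \<star> \<one> X) \<bullet> (\<one> X \<star> c)) \<bullet> coev"
    by simp
  also have "\<dots> = e\<dagger> \<bullet> ((b \<circledast> c) \<bullet> e)"
    by (simp add: conv_def tns_cmp)
  also have "\<dots> = \<mu> \<odot> (e\<dagger> \<bullet> e)"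
    by (simp add: \<mu>)
  finally have cbc: "closure (b \<bullet> c) = \<mu> \<odot> (e\<dagger> \<bullet> e)" .
  have "closure c = e\<dagger> \<bullet> (c \<circledast> \<one> X) \<bullet> e"
    by (simp add: closure_def conv_def)
  then have cc: "closure c = \<nu> \<odot> (e\<dagger> \<bullet> e)"
    by (simp add: \<nu>)
  have cF: "closure (b \<circledast> c) = \<nu> \<odot> closure b"
    unfolding closure_conv[OF biprojection_simps(1-3)[OF b] biprojection_simps(1-3)[OF c]] \<nu>
    by (simp add: closure_def)
  show ?thesis
    using that[OF cbc cc cF Fb Fc FF] .
qed

lemma unbending:
  assumes [simp]: "arr q" "dom q = X" "cod q = X"
  shows "q = (\<one> X \<star> ev) \<bullet> (((q \<star> \<one> X) \<bullet> coev) \<star> \<one> X)"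
proof -
  have "(\<one> X \<star> ev) \<bullet> (((q \<star> \<one> X) \<bullet> coev) \<star> \<one> X)
      = ((\<one> X \<star> ev) \<bullet> (q \<star> \<one> (X \<diamondop> X))) \<bullet> (coev \<star> \<one> X)"
    by (simp add: whisker_cmp)
  also have "(\<one> X \<star> ev) \<bullet> (q \<star> \<one> (X \<diamondop> X)) = q \<bullet> (\<one> X \<star> ev)"
    using interchange[of q ev] by simp
  also have "(q \<bullet> (\<one> X \<star> ev)) \<bullet> (coev \<star> \<one> X) = q \<bullet> (\<one> X \<star> e\<dagger>) \<bullet> ((\<one> X \<star> m) \<bullet> (m\<dagger> \<star> \<one> X)) \<bullet> (e \<star> \<one> X)"
    by (simp add: whisker_cmp)
  also have "\<dots> = q \<bullet> ((\<one> X \<star> e\<dagger>) \<bullet> m\<dagger>) \<bullet> (m \<bullet> (e \<star> \<one> X))"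
    unfolding frobenius_left by simp
  also have "\<dots> = q"
    unfolding counit_right unit_left by simp
  finally show ?thesis ..
qed

end

section \<open>Separated sets in finite-dimensional Hilbert spaces\<close>

text \<open>
  A finite-dimensional Hilbert space as a subspace of a complex vector space that carries no
  topology of its own; the form is controlled on the subspace only.
\<close>

locale hermitian_space = vector_space scl
  for scl :: "complex \<Rightarrow> 'm::ab_group_add \<Rightarrow> 'm" +
  fixes V :: "'m set" and ip :: "'m \<Rightarrow> 'm \<Rightarrow> complex"
  assumes subspace_V: "subspace V"
    and ip_add_right: "\<lbrakk>x \<in> V; y \<in> V; z \<in> V\<rbrakk> \<Longrightarrow> ip x (y + z) = ip x y + ip x z"
    and ip_scl_right: "\<lbrakk>x \<in> V; y \<in> V\<rbrakk> \<Longrightarrow> ip x (scl c y) = c * ip x y"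
    and ip_cnj: "\<lbrakk>x \<in> V; y \<in> V\<rbrakk> \<Longrightarrow> ip y x = cnj (ip x y)"
    and ip_nonneg: "x \<in> V \<Longrightarrow> 0 \<le> Re (ip x x)"
    and ip_definite: "\<lbrakk>x \<in> V; ip x x = 0\<rbrakk> \<Longrightarrow> x = 0"
begin

lemma ip_zero_right: "x \<in> V \<Longrightarrow> ip x 0 = 0"
  using ip_scl_right[of x x 0] by simp

lemma ip_diff_right:
  assumes "x \<in> V" "y \<in> V" "z \<in> V"
  shows "ip x (y - z) = ip x y - ip x z"
  using ip_add_right[of x "y - z" z] subspace_diff[OF subspace_V] assms by simp

lemma ip_sum_right:
  assumes "x \<in> V" "\<And>u. u \<in> B \<Longrightarrow> f u \<in> V"
  shows "ip x (\<Sum>u\<in>B. f u) = (\<Sum>u\<in>B. ip x (f u))"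
  using assms(2)
  by (induction B rule: infinite_finite_induct)
    (simp_all add: ip_zero_right ip_add_right assms(1) subspace_sum[OF subspace_V])

lemma ip_self: "x \<in> V \<Longrightarrow> ip x x = complex_of_real (Re (ip x x))"
  using ip_cnj[of x x] by (simp add: complex_eq_iff)

definition orthogonal_set :: "'m set \<Rightarrow> bool" where
  "orthogonal_set B \<longleftrightarrow> finite B \<and> B \<subseteq> V \<and> 0 \<notin> B \<and> (\<forall>u\<in>B. \<forall>v\<in>B. u \<noteq> v \<longrightarrow> ip u v = 0)"

definition proj_on :: "'m set \<Rightarrow> 'm \<Rightarrow> 'm" where
  "proj_on B v = (\<Sum>u\<in>B. scl (ip u v / ip u u) u)"

context
  fixes B assumes B: "orthogonal_set B"
begin

lemma proj_on_span: "proj_on B v \<in> span B"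
  unfolding proj_on_def by (intro span_sum span_scale span_base)

lemma span_B: "span B \<subseteq> V"
  using B span_minimal subspace_V unfolding orthogonal_set_def by blast

lemma ip_residual:
  assumes "w \<in> B" "v \<in> V"
  shows "ip w (v - proj_on B v) = 0"
proof -
  have w: "w \<in> V" and fin: "finite B" and "B \<subseteq> V"
    using B assms by (auto simp: orthogonal_set_def)
  have "ip w (proj_on B v) = (\<Sum>u\<in>B. (ip u v / ip u u) * ip w u)"
    unfolding proj_on_def using w \<open>B \<subseteq> V\<close>
    by (subst ip_sum_right) (auto simp: ip_scl_right subspace_scale[OF subspace_V] subset_iff)
  also have "\<dots> = (\<Sum>u\<in>B. if u = w then ip w v else 0)"
    using assms B ip_definite
    by (intro sum.cong) (auto simp: orthogonal_set_def)
  also have "\<dots> = ip w v"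
    using fin assms by simp
  finally show ?thesis
    using w assms span_B proj_on_span by (subst ip_diff_right) auto
qed

lemma proj_on_eq:
  assumes v: "v \<in> span B"
  shows "proj_on B v = v"
proof -
  define w where "w = v - proj_on B v"
  have "w \<in> span B"
    unfolding w_def using v proj_on_span by (rule span_diff)
  then have w: "w \<in> V"
    using span_B by blast
  have "subspace {x \<in> V. ip w x = 0}"
    using subspace_V w
    by (auto simp: subspace_def ip_zero_right ip_add_right ip_scl_right)
  moreover have "B \<subseteq> {x \<in> V. ip w x = 0}"
  proof
    fix u assume "u \<in> B"
    then have "u \<in> V"
      using B by (auto simp: orthogonal_set_def)
    then show "u \<in> {x \<in> V. ip w x = 0}"
      using ip_cnj[of u w] ip_residual[of u v] \<open>u \<in> B\<close> w v span_B w_def by auto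
  qed
  ultimately have "span B \<subseteq> {x \<in> V. ip w x = 0}"
    by (rule span_minimal[rotated])
  then have "w = 0"
    using \<open>w \<in> span B\<close> w ip_definite by auto
  then show ?thesis
    by (simp add: w_def)
qed

lemma parseval:
  assumes v: "v \<in> span B"
  shows "Re (ip v v) = (\<Sum>u\<in>B. (cmod (ip u v))\<^sup>2 / Re (ip u u))"
proof -
  have V: "v \<in> V" "B \<subseteq> V"
    using v span_B B by (auto simp: orthogonal_set_def)
  have "ip v v = ip v (proj_on B v)"
    using proj_on_eq[OF v] by simp
  also have "\<dots> = (\<Sum>u\<in>B. (ip u v / ip u u) * ip v u)"
    unfolding proj_on_def using V
    by (subst ip_sum_right) (auto simp: ip_scl_right subspace_scale[OF subspace_V] subset_iff)
  also have "\<dots> = (\<Sum>u\<in>B. complex_of_real ((cmod (ip u v))\<^sup>2 / Re (ip u u)))"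
  proof (rule sum.cong)
    fix u assume "u \<in> B"
    then have u: "u \<in> V"
      using V by auto
    have "(ip u v / ip u u) * ip v u = (ip u v * cnj (ip u v)) / ip u u"
      using ip_cnj[OF u V(1)] by simp
    also have "\<dots> = complex_of_real ((cmod (ip u v))\<^sup>2) / complex_of_real (Re (ip u u))"
      using ip_self[OF u] complex_norm_square[of "ip u v"] by simp
    finally show "(ip u v / ip u u) * ip v u = complex_of_real ((cmod (ip u v))\<^sup>2 / Re (ip u u))"
      by simp
  qed simp
  finally show ?thesis
    by simp
qed

end

text \<open>
  Gram-Schmidt orthogonalisation.
\<close>

lemma orthogonal_set_exists:
  assumes "finite S" "S \<subseteq> V"
  shows "\<exists>B. orthogonal_set B \<and> span B = span S"
  using assms
proof (induction S)
  case empty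
  have "orthogonal_set {}"
    by (simp add: orthogonal_set_def)
  then show ?case
    by blast
next
  case (insert a S)
  then obtain B where B: "orthogonal_set B" "span B = span S"
    by auto
  define a' where "a' = a - proj_on B a"
  have a': "a' \<in> V"
    unfolding a'_def using insert.prems span_B[OF B(1)] proj_on_span[OF B(1)]
    by (intro subspace_diff[OF subspace_V]) auto
  have "a - a' \<in> span B"
    using proj_on_span[OF B(1)] by (simp add: a'_def)
  then have span_eq: "span (insert a' B) = span (insert a S)"
    using eq_span_insert_eq[of a a' B] span_insert[of a B] span_insert[of a S] B(2) by simp
  show ?case
  proof (cases "a' = 0")
    case True
    then show ?thesis
      using B(1) span_eq by auto
  next
    case False
    have "ip u a' = 0" "ip a' u = 0" if "u \<in> B" for u
    proof -
      show "ip u a' = 0"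
        unfolding a'_def using ip_residual[OF B(1) that] insert.prems by auto
      then show "ip a' u = 0"
        using ip_cnj[of u a'] a' that B(1) by (auto simp: orthogonal_set_def)
    qed
    then have "orthogonal_set (insert a' B)"
      using B(1) False a' unfolding orthogonal_set_def by auto
    then show ?thesis
      using span_eq by blast
  qed
qed

text \<open>
  The coordinates with respect to an orthogonal basis are rounded to a grid. Boundedness leaves
  finitely many grid points, and by Parseval's identity two points of the set in the same cell of a fine
  grid would be too close to each other.
\<close>

lemma finite_separated:
  assumes S: "finite S" "span S = V" and P: "P \<subseteq> V"
    and bound: "\<And>p. p \<in> P \<Longrightarrow> Re (ip p p) \<le> M"
    and d: "d > 0" and sep: "\<And>p q. \<lbrakk>p \<in> P; q \<in> P; p \<noteq> q\<rbrakk> \<Longrightarrow> d \<le> Re (ip (p - q) (p - q))"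
  shows "finite P"
proof -
  have "S \<subseteq> V"
    using S(2) span_superset by blast
  then obtain B where B: "orthogonal_set B" and span_B: "span B = V"
    using orthogonal_set_exists[OF S(1)] S(2) by auto
  then have fin: "finite B" and BV: "B \<subseteq> V"
    by (auto simp: orthogonal_set_def)
  have pos: "0 < Re (ip u u)" if "u \<in> B" for u
    using that ip_nonneg[of u] ip_definite[of u] ip_self[of u] B
    by (auto simp: orthogonal_set_def less_le)
  define N where "N = (\<Sum>u\<in>B. 1 / Re (ip u u))"
  have "0 \<le> N"
    unfolding N_def using pos by (intro sum_nonneg) (simp add: less_imp_le)
  \<comment> \<open>The grid has mesh \<open>1 / K\<close>; points of one cell have squared distance at most \<open>2 N / K\<^sup>2 < d\<close>.\<close>
  define K where "K = sqrt (2 * (N + 1) / d)"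
  have "K > 0"
    using \<open>0 \<le> N\<close> d by (simp add: K_def)
  have "K\<^sup>2 = 2 * (N + 1) / d"
    using \<open>0 \<le> N\<close> d by (simp add: K_def)
  moreover have "N + 1 > 0"
    using \<open>0 \<le> N\<close> by simp
  ultimately have K2: "2 / K\<^sup>2 = d / (N + 1)"
    using d by (simp del: distrib_left_numeral)
  define R where "R u = \<lceil>K * sqrt (Re (ip u u) * M)\<rceil>" for u
  define \<Phi> where "\<Phi> p = (\<lambda>u\<in>B. (\<lfloor>K * Re (ip u p)\<rfloor>, \<lfloor>K * Im (ip u p)\<rfloor>))" for p
  have coordinate_bound: "cmod (ip u p) \<le> sqrt (Re (ip u u) * M)" if "p \<in> P" "u \<in> B" for p u
  proof -
    have "(cmod (ip u p))\<^sup>2 / Re (ip u u) \<le> Re (ip p p)"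
      unfolding parseval[OF B, of p, unfolded span_B, OF subsetD[OF P that(1)]]
      using fin that pos by (intro member_le_sum) (auto simp: less_imp_le)
    also have "\<dots> \<le> M"
      by (rule bound[OF that(1)])
    finally show ?thesis
      using pos[OF that(2)]
      by (intro real_le_rsqrt) (simp add: field_simps)
  qed
  have "\<Phi> ` P \<subseteq> (\<Pi>\<^sub>E u\<in>B. {- R u..R u} \<times> {- R u..R u})"
  proof -
    have "\<lfloor>K * x\<rfloor> \<in> {- R u..R u}" if "\<bar>x\<bar> \<le> sqrt (Re (ip u u) * M)" for x u
    proof -
      have "\<bar>K * x\<bar> \<le> K * sqrt (Re (ip u u) * M)"
        using that \<open>K > 0\<close> by (simp add: abs_mult)
      then show ?thesis
        unfolding R_def by (auto simp: abs_le_iff) linarith+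
    qed
    then have "\<lfloor>K * Re (ip u p)\<rfloor> \<in> {- R u..R u} \<and> \<lfloor>K * Im (ip u p)\<rfloor> \<in> {- R u..R u}"
      if "p \<in> P" "u \<in> B" for p u
      using order_trans[OF abs_Re_le_cmod coordinate_bound[OF that]]
        order_trans[OF abs_Im_le_cmod coordinate_bound[OF that]] by blast
    then show ?thesis
      by (auto simp: \<Phi>_def)
  qed
  moreover have "finite (\<Pi>\<^sub>E u\<in>B. {- R u..R u} \<times> {- R u..R u})"
    using fin by (intro finite_PiE) auto
  ultimately have "finite (\<Phi> ` P)"
    by (rule finite_subset)
  moreover have "inj_on \<Phi> P"
  proof (rule inj_onI, rule ccontr)
    fix p q assume pq: "p \<in> P" "q \<in> P" "\<Phi> p = \<Phi> q" "p \<noteq> q"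
    have V: "p \<in> V" "q \<in> V" "p - q \<in> V"
      using pq P subspace_diff[OF subspace_V] by auto
    have "(cmod (ip u (p - q)))\<^sup>2 \<le> 2 / K\<^sup>2" if "u \<in> B" for u
    proof -
      have eq: "\<lfloor>K * Re (ip u p)\<rfloor> = \<lfloor>K * Re (ip u q)\<rfloor>" "\<lfloor>K * Im (ip u p)\<rfloor> = \<lfloor>K * Im (ip u q)\<rfloor>"
        using fun_cong[OF pq(3), of u] that by (auto simp: \<Phi>_def)
      have diff: "ip u (p - q) = ip u p - ip u q"
        using that BV V by (intro ip_diff_right) auto
      have "\<bar>K * Re (ip u (p - q))\<bar> \<le> 1" "\<bar>K * Im (ip u (p - q))\<bar> \<le> 1"
        unfolding diff using eq by (simp_all add: right_diff_distrib) linarith+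
      then have "(K * Re (ip u (p - q)))\<^sup>2 + (K * Im (ip u (p - q)))\<^sup>2 \<le> 1 + 1"
        by (intro add_mono) (simp_all add: abs_square_le_1)
      then have "K\<^sup>2 * (cmod (ip u (p - q)))\<^sup>2 \<le> 2"
        by (simp add: cmod_power2 power_mult_distrib distrib_left)
      then show ?thesis
        using \<open>K > 0\<close> by (simp add: field_simps)
    qed
    then have "Re (ip (p - q) (p - q)) \<le> (\<Sum>u\<in>B. (2 / K\<^sup>2) / Re (ip u u))"
      unfolding parseval[OF B, of "p - q", unfolded span_B, OF V(3)]
      using pos by (intro sum_mono divide_right_mono) (auto simp: less_imp_le)
    also have "\<dots> = (2 / K\<^sup>2) * N"
      by (simp add: N_def sum_distrib_left)
    also have "\<dots> < d"
      unfolding K2 using \<open>0 \<le> N\<close> d by (simp add: field_simps)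
    finally show False
      using sep[OF pq(1,2,4)] by simp
  qed
  ultimately show ?thesis
    by (rule finite_imageD)
qed

end

section \<open>Arrows of a unitary tensor category\<close>

text \<open>
  Attaching source and target to the morphisms of \<open>C\<close> makes the diagrammatic calculus available; an
  equation between arrows amounts to one between morphisms.
\<close>

datatype ('o, 'm) arrow = Arrow (src: 'o) (tgt: 'o) (mor: 'm)

definition valid :: "('o, 'm) dagger_monoidal \<Rightarrow> ('o, 'm) arrow \<Rightarrow> bool" where
  "valid C f \<longleftrightarrow> mor f \<in> Hom C (src f) (tgt f)"

definition arrow_ident :: "('o, 'm) dagger_monoidal \<Rightarrow> 'o \<Rightarrow> ('o, 'm) arrow" where
  "arrow_ident C A = Arrow A A (ident C A)"

definition arrow_comp ::
    "('o, 'm) dagger_monoidal \<Rightarrow> ('o, 'm) arrow \<Rightarrow> ('o, 'm) arrow \<Rightarrow> ('o, 'm) arrow" where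
  "arrow_comp C g f = Arrow (src f) (tgt g) (mor g \<cdot>\<^bsub>C\<^esub> mor f)"

definition arrow_tens ::
    "('o, 'm) dagger_monoidal \<Rightarrow> ('o, 'm) arrow \<Rightarrow> ('o, 'm) arrow \<Rightarrow> ('o, 'm) arrow" where
  "arrow_tens C f g = Arrow (src f \<boxtimes>\<^bsub>C\<^esub> src g) (tgt f \<boxtimes>\<^bsub>C\<^esub> tgt g) (mor f \<otimes>\<^bsub>C\<^esub> mor g)"

definition arrow_dag :: "('o, 'm) dagger_monoidal \<Rightarrow> ('o, 'm) arrow \<Rightarrow> ('o, 'm) arrow" where
  "arrow_dag C f = Arrow (tgt f) (src f) (dag C (mor f))"

definition arrow_scl :: "('o, 'm) dagger_monoidal \<Rightarrow> complex \<Rightarrow> ('o, 'm) arrow \<Rightarrow> ('o, 'm) arrow" where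
  "arrow_scl C z f = Arrow (src f) (tgt f) (scl C z (mor f))"

lemmas arrow_defs = valid_def arrow_ident_def arrow_comp_def arrow_tens_def arrow_dag_def arrow_scl_def

context unitary_tensor_category
begin

lemma Hom_zero: "0 \<in> Hom C A B"
  using subspace_0[OF subspace_Hom] .

lemma Hom_diff: "\<lbrakk>f \<in> Hom C A B; g \<in> Hom C A B\<rbrakk> \<Longrightarrow> f - g \<in> Hom C A B"
  by (rule subspace_diff[OF subspace_Hom])

lemma Hom_scl: "f \<in> Hom C A B \<Longrightarrow> scl C z f \<in> Hom C A B"
  by (rule subspace_scale[OF subspace_Hom])

lemma comp_zero_right: "g \<in> Hom C B D \<Longrightarrow> g \<cdot> 0 = 0"
  using comp_scl_right[OF Hom_zero[of B B], of g D 0] by simp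

lemma dag_zero: "dag C 0 = 0"
  using dag_scl[OF Hom_zero, of 0] by simp

lemma scl_ident_comp: "scl C z (ident C A) \<cdot> scl C w (ident C A) = scl C (z * w) (ident C A)"
  using comp_scl_left[OF Hom_scl ident_in_Hom, OF ident_in_Hom] comp_ident[OF ident_in_Hom]
    comp_scl_right[OF ident_in_Hom ident_in_Hom]
  by simp

lemma cnorm_zero: "cnorm C A 0 = 0"
proof -
  have "z = 0" if "z \<in> spec C A (dag C 0 \<cdot> 0)" for z
  proof (rule ccontr)
    assume "z \<noteq> 0"
    have "dag C 0 \<cdot> 0 = 0"
      using comp_zero_right[OF Hom_zero] by (simp add: dag_zero)
    moreover have "is_iso C A A (scl C w (ident C A))" if "w \<noteq> 0" for w
      unfolding is_iso_def
      using ident_in_Hom[of A] that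
      by (intro conjI bexI[of _ "scl C (inverse w) (ident C A)"] Hom_scl)
        (simp_all add: scl_ident_comp)
    from this[of "- z"] have "is_iso C A A (scl C (- z) (ident C A))"
      using \<open>z \<noteq> 0\<close> by simp
    ultimately show False
      using that by (simp add: spec_def)
  qed
  then have spec: "insert 0 (cmod ` spec C A (dag C 0 \<cdot> 0)) = {0}"
    by auto
  show ?thesis
    unfolding cnorm_def spec by simp
qed

lemma dag_comp_definite:
  assumes "f \<in> Hom C A B" "dag C f \<cdot> f = 0"
  shows "f = 0"
proof -
  have "(cnorm C A f)\<^sup>2 = 0"
    using cnorm_cstar[OF assms(1)] assms(2) cnorm_zero by simp
  then show ?thesis
    using cnorm_definite assms(1) by simp
qed

lemma arrow_calculus:
  "dagger_tensor_calculus (valid C) src tgt (unit_obj C) (tobj C) (arrow_ident C) (arrow_comp C)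
     (arrow_tens C) (arrow_dag C) (arrow_scl C)"
proof
  fix f f' g g' h :: "('a, 'b) arrow" and A B D and z w
  show "(A \<boxtimes> B) \<boxtimes> D = A \<boxtimes> (B \<boxtimes> D)"
    by (rule tobj_assoc)
  show "unit_obj C \<boxtimes> A = A" "A \<boxtimes> unit_obj C = A"
    by (rule tobj_unit_left tobj_unit_right)+
  show "valid C (arrow_ident C A)"
    by (simp add: arrow_defs ident_in_Hom)
  show "valid C (arrow_dag C f)" if "valid C f"
    using that by (simp add: arrow_defs dag_in_Hom)
  show "valid C (arrow_scl C z f)" if "valid C f"
    using that by (simp add: arrow_defs Hom_scl)
  show "valid C (arrow_comp C g f)" if "valid C f" "valid C g" "src g = tgt f"
    using that by (simp add: arrow_defs comp_in_Hom)
  show "valid C (arrow_tens C f g)" if "valid C f" "valid C g"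
    using that by (simp add: arrow_defs tens_in_Hom)
  show "arrow_comp C f (arrow_ident C A) = f" if "valid C f" "src f = A"
    using that by (cases f) (auto simp: arrow_defs comp_ident)
  show "arrow_comp C (arrow_ident C A) f = f" if "valid C f" "tgt f = A"
    using that by (cases f) (auto simp: arrow_defs ident_comp)
  show "arrow_comp C (arrow_comp C h g) f = arrow_comp C h (arrow_comp C g f)"
    if "valid C f" "valid C g" "valid C h" "src g = tgt f" "src h = tgt g"
    using that by (auto simp: arrow_defs intro: comp_assoc)
  show "arrow_tens C (arrow_ident C A) (arrow_ident C B) = arrow_ident C (A \<boxtimes> B)"
    by (simp add: arrow_defs tens_ident)
  show "arrow_comp C (arrow_tens C f' g') (arrow_tens C f g) = arrow_tens C (arrow_comp C f' f) (arrow_comp C g' g)"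
    if "valid C f" "valid C f'" "valid C g" "valid C g'" "src f' = tgt f" "src g' = tgt g"
    using that by (auto simp: arrow_defs intro: tens_comp[symmetric])
  show "arrow_tens C (arrow_tens C f g) h = arrow_tens C f (arrow_tens C g h)"
    if "valid C f" "valid C g" "valid C h"
    using that by (auto simp: arrow_defs tobj_assoc intro: tens_assoc)
  show "arrow_tens C (arrow_ident C (unit_obj C)) f = f" "arrow_tens C f (arrow_ident C (unit_obj C)) = f"
    if "valid C f"
    using that by (cases f; simp add: arrow_defs tobj_unit_left tobj_unit_right tens_unit_left tens_unit_right)+
  show "arrow_dag C (arrow_dag C f) = f" if "valid C f"
    using that by (cases f) (simp add: arrow_defs dag_dag)
  show "arrow_dag C (arrow_ident C A) = arrow_ident C A"
    by (simp add: arrow_defs dag_ident)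
  show "arrow_dag C (arrow_comp C g f) = arrow_comp C (arrow_dag C f) (arrow_dag C g)"
    if "valid C f" "valid C g" "src g = tgt f"
    using that by (auto simp: arrow_defs intro: dag_comp)
  show "arrow_dag C (arrow_tens C f g) = arrow_tens C (arrow_dag C f) (arrow_dag C g)"
    if "valid C f" "valid C g"
    using that by (auto simp: arrow_defs intro: dag_tens)
  show "arrow_dag C (arrow_scl C z f) = arrow_scl C (cnj z) (arrow_dag C f)" if "valid C f"
    using that by (auto simp: arrow_defs intro: dag_scl)
  show "arrow_comp C (arrow_scl C z g) f = arrow_scl C z (arrow_comp C g f)"
    "arrow_comp C g (arrow_scl C z f) = arrow_scl C z (arrow_comp C g f)"
    if "valid C f" "valid C g" "src g = tgt f"
    using that by (auto simp: arrow_defs intro: comp_scl_left comp_scl_right)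
  show "arrow_tens C (arrow_scl C z f) g = arrow_scl C z (arrow_tens C f g)"
    "arrow_tens C f (arrow_scl C z g) = arrow_scl C z (arrow_tens C f g)"
    if "valid C f" "valid C g"
    using that by (auto simp: arrow_defs intro: tens_scl_left tens_scl_right)
  show "f = arrow_scl C 0 f"
    if "valid C f" "arrow_comp C (arrow_dag C f) f = arrow_scl C 0 (arrow_ident C (src f))"
    using that dag_comp_definite[of "mor f" "src f" "tgt f"] by (cases f) (simp add: arrow_defs)
qed (simp_all add: arrow_defs)

lemma unitary_frobenius_arrows:
  assumes "unitary_frobenius_algebra C F"
  shows "unitary_frobenius_object (valid C) src tgt (unit_obj C) (tobj C) (arrow_ident C) (arrow_comp C)
     (arrow_tens C) (arrow_dag C) (arrow_scl C) (fobj F)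
     (Arrow (fobj F \<boxtimes> fobj F) (fobj F) (mult F)) (Arrow (unit_obj C) (fobj F) (funit F))"
  using assms
  by (intro unitary_frobenius_object.intro unitary_frobenius_object_axioms.intro arrow_calculus)
    (simp_all add: unitary_frobenius_algebra_def frobenius_algebra_def unital_algebra_def arrow_defs
      tobj_assoc tobj_unit_left tobj_unit_right)

end

section \<open>The trace on the endomorphisms of a connected Frobenius algebra\<close>

locale connected_unitary_frobenius = unitary_tensor_category +
  fixes X
  assumes unitary_X: "unitary_frobenius_algebra C X"
    and connected_X: "connected_frobenius C X"
begin

abbreviation M where "M \<equiv> Arrow (fobj X \<boxtimes> fobj X) (fobj X) (mult X)"
abbreviation E where "E \<equiv> Arrow (unit_obj C) (fobj X) (funit X)"

lemma X_Hom:
  "mult X \<in> Hom C (fobj X \<boxtimes> fobj X) (fobj X)" "funit X \<in> Hom C (unit_obj C) (fobj X)"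
  "comult X = dag C (mult X)" "counit X = dag C (funit X)"
  using unitary_X
  by (auto simp: unitary_frobenius_algebra_def frobenius_algebra_def unital_algebra_def)

lemma unit_spans_Hom: "funit X \<noteq> 0" "f \<in> Hom C (unit_obj C) (fobj X) \<Longrightarrow> \<exists>z. f = scl C z (funit X)"
proof -
  let ?V = "Hom C (unit_obj C) (fobj X)"
  obtain B where B: "B \<subseteq> ?V" "independent B" "?V \<subseteq> span B" "card B = dim ?V"
    using basis_exists by blast
  then obtain u where u: "B = {u}"
    using connected_X by (auto simp: connected_frobenius_def card_1_singleton_iff)
  have u0: "u \<noteq> 0"
    using B(2) u dependent_zero by auto
  have ex: "\<exists>k. f = scl C k u" if "f \<in> ?V" for f
    using that B(3) u by (auto simp: span_singleton)
  show nz: "funit X \<noteq> 0"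
  proof
    assume e: "funit X = 0"
    have "ident C (fobj X) = mult X \<cdot> (funit X \<otimes> ident C (fobj X))"
      using unitary_X by (simp add: unitary_frobenius_algebra_def frobenius_algebra_def unital_algebra_def)
    also have "funit X \<otimes> ident C (fobj X) = 0"
      using tens_scl_left[OF Hom_zero ident_in_Hom, of 0] by (simp add: e)
    also have "mult X \<cdot> 0 = 0"
      by (rule comp_zero_right[OF X_Hom(1)])
    finally have "ident C (fobj X) = 0" .
    moreover have "u = ident C (fobj X) \<cdot> u"
      using B(1) u ident_comp[of u] by auto
    ultimately have "u = 0 \<cdot> u"
      by simp
    also have "\<dots> = 0"
      using comp_scl_left[of u "unit_obj C" "fobj X" 0 "fobj X" 0] B(1) u Hom_zero by simp
    finally show False
      using u0 by simp
  qed
  show "\<exists>z. f = scl C z (funit X)" if f: "f \<in> ?V"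
  proof -
    obtain k l where kl: "f = scl C k u" "funit X = scl C l u"
      using ex[OF f] ex[OF X_Hom(2)] by auto
    with nz have "f = scl C (k / l) (funit X)"
      by auto
    then show ?thesis ..
  qed
qed

sublocale X: connected_frobenius_object "valid C" src tgt "unit_obj C" "tobj C" "arrow_ident C" "arrow_comp C"
     "arrow_tens C" "arrow_dag C" "arrow_scl C" "fobj X" M E
proof (intro connected_frobenius_object.intro connected_frobenius_object_axioms.intro
    unitary_frobenius_arrows unitary_X)
  show "E \<noteq> arrow_scl C 0 E"
    using unit_spans_Hom(1) by (simp add: arrow_defs)
  fix f assume "valid C f" "src f = unit_obj C" "tgt f = fobj X"
  then show "\<exists>z. f = arrow_scl C z E"
    using unit_spans_Hom(2)[of "mor f"] by (cases f) (auto simp: arrow_defs)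
qed


lemma scalar_unique: "g \<in> Hom C (unit_obj C) (unit_obj C) \<Longrightarrow> \<exists>!z. g = scl C z (ident C (unit_obj C))"
  using End_unit unfolding bij_betw_def inj_on_def by (auto simp: image_iff)

lemma scl_ident_cancel: "scl C z (ident C (unit_obj C)) = scl C w (ident C (unit_obj C)) \<Longrightarrow> z = w"
  using End_unit unfolding bij_betw_def inj_on_def by auto

definition cup where "cup = dag C (mult X) \<cdot> funit X"
definition cap where "cap = dag C (funit X) \<cdot> mult X"

lemma cup_Hom: "cup \<in> Hom C (unit_obj C) (fobj X \<boxtimes> fobj X)"
  and cap_Hom: "cap \<in> Hom C (fobj X \<boxtimes> fobj X) (unit_obj C)"
  and dag_cup: "dag C cup = cap"
  unfolding cup_def cap_def using X_Hom(1,2)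
  by (auto intro: comp_in_Hom dag_in_Hom simp: dag_comp[OF _ dag_in_Hom] dag_dag)

text \<open>
  The vector of \<open>Hom 1 (X \<otimes> X)\<close> that corresponds to \<open>f\<close> under the selfduality of \<open>X\<close>. The
  trace form on \<open>End X\<close> is the inner product of these vectors, hence positive definite.
\<close>

definition bend where "bend f = (f \<otimes> ident C (fobj X)) \<cdot> cup"

lemma tens_ident_Hom:
  "f \<in> Hom C (fobj X) (fobj X) \<Longrightarrow>
    f \<otimes> ident C (fobj X) \<in> Hom C (fobj X \<boxtimes> fobj X) (fobj X \<boxtimes> fobj X)"
  by (intro tens_in_Hom ident_in_Hom)

lemma bend_Hom: "f \<in> Hom C (fobj X) (fobj X) \<Longrightarrow> bend f \<in> Hom C (unit_obj C) (fobj X \<boxtimes> fobj X)"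
  unfolding bend_def by (intro comp_in_Hom[OF cup_Hom] tens_in_Hom ident_in_Hom)

definition tr where "tr f = (THE z. cap \<cdot> bend f = scl C z (ident C (unit_obj C)))"

lemma tr_eq: "f \<in> Hom C (fobj X) (fobj X) \<Longrightarrow> cap \<cdot> bend f = scl C (tr f) (ident C (unit_obj C))"
  unfolding tr_def by (rule theI'[OF scalar_unique]) (intro comp_in_Hom[OF bend_Hom cap_Hom])

lemma tr_unique: "cap \<cdot> bend f = scl C z (ident C (unit_obj C)) \<Longrightarrow> tr f = z"
  unfolding tr_def by (rule the_equality) (metis scl_ident_cancel)+

lemma tr_add:
  assumes "f \<in> Hom C (fobj X) (fobj X)" "g \<in> Hom C (fobj X) (fobj X)"
  shows "tr (f + g) = tr f + tr g"
proof (rule tr_unique)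
  have "bend (f + g) = bend f + bend g"
    unfolding bend_def using assms
    by (simp add: tens_add_left[OF _ _ ident_in_Hom] comp_add_left[OF cup_Hom tens_ident_Hom tens_ident_Hom])
  then show "cap \<cdot> bend (f + g) = scl C (tr f + tr g) (ident C (unit_obj C))"
    using assms by (simp add: comp_add_right[OF bend_Hom bend_Hom cap_Hom] tr_eq scale_left_distrib)
qed

lemma tr_scl:
  assumes "f \<in> Hom C (fobj X) (fobj X)"
  shows "tr (scl C z f) = z * tr f"
proof (rule tr_unique)
  have "bend (scl C z f) = scl C z (bend f)"
    unfolding bend_def using assms
    by (simp add: tens_scl_left[OF _ ident_in_Hom] comp_scl_left[OF cup_Hom tens_ident_Hom])
  then show "cap \<cdot> bend (scl C z f) = scl C (z * tr f) (ident C (unit_obj C))"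
    using assms by (simp add: comp_scl_right[OF bend_Hom cap_Hom] tr_eq)
qed

lemma tr_diff:
  assumes "f \<in> Hom C (fobj X) (fobj X)" "g \<in> Hom C (fobj X) (fobj X)"
  shows "tr (f - g) = tr f - tr g"
  using tr_add[OF Hom_diff[OF assms] assms(2)] by simp

lemma dag_bend_bend:
  assumes "f \<in> Hom C (fobj X) (fobj X)" "g \<in> Hom C (fobj X) (fobj X)"
  shows "dag C (bend f) \<cdot> bend g = scl C (tr (dag C f \<cdot> g)) (ident C (unit_obj C))"
proof -
  let ?i = "ident C (fobj X)"
  have fi: "f \<otimes> ?i \<in> Hom C (fobj X \<boxtimes> fobj X) (fobj X \<boxtimes> fobj X)"
    and gi: "g \<otimes> ?i \<in> Hom C (fobj X \<boxtimes> fobj X) (fobj X \<boxtimes> fobj X)"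
    using assms by (auto intro: tens_in_Hom ident_in_Hom)
  have "dag C (bend f) = cap \<cdot> (dag C f \<otimes> ?i)"
    unfolding bend_def using assms
    by (simp add: dag_comp[OF cup_Hom fi] dag_cup dag_tens[OF _ ident_in_Hom] dag_ident)
  moreover have di: "dag C f \<otimes> ?i \<in> Hom C (fobj X \<boxtimes> fobj X) (fobj X \<boxtimes> fobj X)"
    using assms by (auto intro: tens_in_Hom ident_in_Hom dag_in_Hom)
  moreover have "(dag C f \<otimes> ?i) \<cdot> bend g = bend (dag C f \<cdot> g)"
    unfolding bend_def
    using comp_assoc[OF cup_Hom gi di] tens_comp[OF assms(2) dag_in_Hom[OF assms(1)] ident_in_Hom[of "fobj X"] ident_in_Hom]
    by (simp add: comp_ident[OF ident_in_Hom])
  ultimately have "dag C (bend f) \<cdot> bend g = cap \<cdot> bend (dag C f \<cdot> g)"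
    using comp_assoc[OF bend_Hom[OF assms(2)] di cap_Hom] by simp
  then show ?thesis
    using tr_eq[OF comp_in_Hom[OF assms(2) dag_in_Hom[OF assms(1)]]] by simp
qed

lemma unbend:
  assumes "f \<in> Hom C (fobj X) (fobj X)"
  shows "f = (ident C (fobj X) \<otimes> cap) \<cdot> (bend f \<otimes> ident C (fobj X))"
  using X.unbending[of "Arrow (fobj X) (fobj X) f"] assms
  by (simp add: arrow_defs bend_def cup_def cap_def)

lemma bend_definite:
  assumes "f \<in> Hom C (fobj X) (fobj X)" "bend f = 0"
  shows "f = 0"
proof -
  have "bend f \<otimes> ident C (fobj X) = 0"
    using tens_scl_left[OF Hom_zero ident_in_Hom, of 0] assms(2) by simp
  then show ?thesis
    using unbend[OF assms(1)]
      comp_zero_right[OF tens_in_Hom[OF ident_in_Hom cap_Hom]] by metis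
qed

text \<open>
  The positivity axiom replaces \<open>w\<close> by an endomorphism of the tensor unit, that is, by a number
  \<open>k\<close>, and \<open>z = |k|\<^sup>2\<close>.
\<close>

lemma dag_comp_scalar:
  assumes "w \<in> Hom C (unit_obj C) A" "dag C w \<cdot> w = scl C z (ident C (unit_obj C))"
  shows "Im z = 0" "Re z \<ge> 0"
proof -
  obtain g where g: "g \<in> Hom C (unit_obj C) (unit_obj C)" "dag C w \<cdot> w = dag C g \<cdot> g"
    using positivity assms(1) by blast
  then obtain k where k: "g = scl C k (ident C (unit_obj C))"
    using scalar_unique by blast
  have "dag C g \<cdot> g = scl C (k * cnj k) (ident C (unit_obj C))"
    unfolding k by (simp add: dag_scl[OF ident_in_Hom] dag_ident scl_ident_comp mult.commute)
  then have "z = k * cnj k"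
    using g(2) assms(2) scl_ident_cancel by metis
  then show "Im z = 0" "Re z \<ge> 0"
    by (simp_all add: complex_mult_cnj)
qed

lemma tr_dag_comp:
  assumes f: "f \<in> Hom C (fobj X) (fobj X)"
  shows "Im (tr (dag C f \<cdot> f)) = 0" "Re (tr (dag C f \<cdot> f)) \<ge> 0" "tr (dag C f \<cdot> f) = 0 \<Longrightarrow> f = 0"
  using dag_comp_scalar[OF bend_Hom[OF f] dag_bend_bend[OF f f]]
    dag_comp_definite[OF bend_Hom[OF f]] bend_definite[OF f] dag_bend_bend[OF f f]
  by auto

lemma tr_dag_comp_sym:
  assumes f: "f \<in> Hom C (fobj X) (fobj X)" and g: "g \<in> Hom C (fobj X) (fobj X)"
  shows "tr (dag C g \<cdot> f) = cnj (tr (dag C f \<cdot> g))"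
proof (rule scl_ident_cancel)
  have "dag C (dag C (bend f) \<cdot> bend g) = dag C (bend g) \<cdot> bend f"
    using bend_Hom[OF f] bend_Hom[OF g] by (simp add: dag_comp[OF _ dag_in_Hom] dag_dag)
  then show "scl C (tr (dag C g \<cdot> f)) (ident C (unit_obj C)) = scl C (cnj (tr (dag C f \<cdot> g))) (ident C (unit_obj C))"
    unfolding dag_bend_bend[OF f g] dag_bend_bend[OF g f] dag_scl[OF ident_in_Hom] dag_ident ..
qed

lemma comp_diff_right:
  assumes "f \<in> Hom C A B" "f' \<in> Hom C A B" "g \<in> Hom C B D"
  shows "g \<cdot> (f - f') = g \<cdot> f - g \<cdot> f'"
  using comp_add_right[OF Hom_diff[OF assms(1,2)] assms(2,3)] by simp

lemma comp_diff_left: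
  assumes "f \<in> Hom C A B" "g \<in> Hom C B D" "g' \<in> Hom C B D"
  shows "(g - g') \<cdot> f = g \<cdot> f - g' \<cdot> f"
  using comp_add_left[OF assms(1) Hom_diff[OF assms(2,3)] assms(3)] by simp

lemma dag_diff:
  assumes "f \<in> Hom C A B" "g \<in> Hom C A B"
  shows "dag C (f - g) = dag C f - dag C g"
  using dag_add[OF Hom_diff[OF assms] assms(2)] by simp

definition projection where
  "projection q \<longleftrightarrow> q \<in> Hom C (fobj X) (fobj X) \<and> dag C q = q \<and> q \<cdot> q = q"

lemma tr_projection:
  assumes "projection q"
  shows "Im (tr q) = 0" "Re (tr q) \<ge> 0"
  using assms tr_dag_comp[of q] unfolding projection_def by auto

lemma cnorm_projection:
  assumes "q \<in> Hom C A A" "dag C q = q" "q \<cdot> q = q"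
  shows "cnorm C A q = 0 \<or> cnorm C A q = 1"
  using cnorm_cstar[OF assms(1)] assms(2,3) by (simp add: power2_eq_square)

text \<open>
  By the zigzag identity \<open>q = (id \<otimes> cap) \<cdot> (bend q \<otimes> id)\<close>. The norm of \<open>q\<close> is 1, and by the
  C*-identity the square of the norm of the second factor is at most \<open>tr q\<close>; so \<open>tr q\<close> is at least
  the inverse square of the norm of the first factor, which does not depend on \<open>q\<close>.
\<close>

lemma projection_trace_bound:
  "\<exists>\<kappa>>0. \<forall>q. projection q \<and> q \<noteq> 0 \<longrightarrow> \<kappa> \<le> Re (tr q)"
proof -
  let ?X = "fobj X" and ?i = "ident C (fobj X)"
  define K where "K = cnorm C (?X \<boxtimes> ?X \<boxtimes> ?X) (?i \<otimes> cap)"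
  have cap': "?i \<otimes> cap \<in> Hom C (?X \<boxtimes> ?X \<boxtimes> ?X) ?X"
    using tens_in_Hom[OF ident_in_Hom cap_Hom] by (simp add: tobj_unit_right)
  have *: "1 \<le> K\<^sup>2 * Re (tr q)" if q: "projection q" "q \<noteq> 0" for q
  proof -
    have qH: "q \<in> Hom C ?X ?X"
      using q by (simp add: projection_def)
    define w where "w = bend q \<otimes> ?i"
    have w: "w \<in> Hom C ?X (?X \<boxtimes> ?X \<boxtimes> ?X)"
      unfolding w_def using tens_in_Hom[OF bend_Hom[OF qH] ident_in_Hom]
      by (simp add: tobj_unit_left tobj_assoc)
    have "dag C w \<cdot> w = (dag C (bend q) \<cdot> bend q) \<otimes> (?i \<cdot> ?i)"
      unfolding w_def
      using dag_tens[OF bend_Hom[OF qH] ident_in_Hom[of ?X]] dag_ident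
        tens_comp[OF bend_Hom[OF qH] dag_in_Hom[OF bend_Hom[OF qH]] ident_in_Hom[of ?X] ident_in_Hom[of ?X]]
      by simp
    also have "\<dots> = scl C (tr q) ?i"
      using q(1) by (simp add: dag_bend_bend[OF qH qH] projection_def comp_ident[OF ident_in_Hom]
        tens_scl_left[OF ident_in_Hom ident_in_Hom] tens_unit_left[OF ident_in_Hom])
    finally have "(cnorm C ?X w)\<^sup>2 = cmod (tr q) * cnorm C ?X ?i"
      using cnorm_cstar[OF w] cnorm_scl[OF ident_in_Hom] by simp
    moreover have "cnorm C ?X ?i \<le> 1"
      using cnorm_projection[OF ident_in_Hom dag_ident comp_ident[OF ident_in_Hom], of ?X] by linarith
    ultimately have w_le: "(cnorm C ?X w)\<^sup>2 \<le> Re (tr q)"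
      using tr_projection[OF q(1)] by (simp add: cmod_eq_Re mult_left_le)
    have "cnorm C ?X q = 1"
      using cnorm_projection[OF qH] cnorm_definite[OF qH] q by (auto simp: projection_def)
    then have "1 \<le> K * cnorm C ?X w"
      using cnorm_comp[OF w cap'] unbend[OF qH] by (simp add: K_def w_def)
    then have "1 \<le> (K * cnorm C ?X w)\<^sup>2"
      by simp
    also have "\<dots> \<le> K\<^sup>2 * Re (tr q)"
      using w_le by (simp add: power_mult_distrib mult_left_mono)
    finally show ?thesis .
  qed
  show ?thesis
  proof (cases "K = 0")
    \<comment> \<open>In this case there is no nonzero projection at all.\<close>
    case True
    then show ?thesis
      using * by (intro exI[of _ 1]) auto
  next
    case False
    then show ?thesis
      using * by (intro exI[of _ "1 / K\<^sup>2"]) (auto simp: field_simps)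
  qed
qed


section \<open>Finiteness\<close>

abbreviation arrow where "arrow f \<equiv> Arrow (fobj X) (fobj X) f"

definition biprojections where "biprojections = {b. X.biprojection (arrow b)}"

lemma biprojection_projection: "b \<in> biprojections \<Longrightarrow> projection b"
  by (auto simp: biprojections_def X.biprojection_def projection_def arrow_defs)

lemma biprojection_nonzero: "b \<in> biprojections \<Longrightarrow> b \<noteq> 0"
proof
  assume "b \<in> biprojections" "b = 0"
  then have "0 \<cdot> funit X = funit X"
    by (auto simp: biprojections_def X.biprojection_def arrow_defs)
  then show False
    using comp_scl_left[OF X_Hom(2) Hom_zero, of 0] unit_spans_Hom(1) by simp
qed

lemma tr_closure:
  assumes "X.closure (arrow f) = arrow_scl C z (Arrow (unit_obj C) (unit_obj C) g)"
    "g = scl C s (ident C (unit_obj C))"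
  shows "tr f = z * s"
  using assms
  by (intro tr_unique) (simp add: X.closure_def arrow_defs bend_def cup_def cap_def)

text \<open>
  The projection \<open>p\<close> is the convolution \<open>F\<close> of \<open>b\<close> and \<open>c\<close>, normalised by the scalar
  \<open>\<mu>\<close> with \<open>F \<cdot> F = \<mu> F\<close>. That \<open>\<mu>\<close> is real and nonzero follows from \<open>tr (F\<^sup>\<dagger> \<cdot> F) = \<mu> tr F\<close>,
  where \<open>tr F\<close> is a nonzero real number, proportional to \<open>tr b * tr c\<close>.
\<close>

lemma join_projection:
  assumes b: "b \<in> biprojections" and c: "c \<in> biprojections"
  obtains p where "projection p" "p \<cdot> b = b" "p \<cdot> c = c" "tr (b \<cdot> c) * tr p = tr b * tr c"
proof -
  let ?S = "Hom C (fobj X) (fobj X)"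
  have bH: "b \<in> ?S" "projection b" and cH: "c \<in> ?S" "projection c"
    using biprojection_projection[OF b] biprojection_projection[OF c] by (auto simp: projection_def)
  define F where "F = mor (X.conv (arrow b) (arrow c))"
  have F: "X.conv (arrow b) (arrow c) = arrow F"
    unfolding F_def X.conv_def by (simp add: arrow_defs)
  obtain s where s: "dag C (funit X) \<cdot> funit X = scl C s (ident C (unit_obj C))"
    using scalar_unique[OF comp_in_Hom[OF X_Hom(2) dag_in_Hom[OF X_Hom(2)]]] by auto
  have bip: "X.biprojection (arrow b)" "X.biprojection (arrow c)"
    using b c by (auto simp: biprojections_def)
  have FH: "F \<in> ?S" "dag C F = F"
    using X.conv_simps[OF X.biprojection_simps(1-3)[OF bip(1)] X.biprojection_simps(1-3)[OF bip(2)]]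
      bH cH unfolding F by (auto simp: arrow_defs projection_def F)
  obtain \<mu> \<nu> where mn: "X.closure (arrow (b \<cdot> c)) = arrow_scl C \<mu> (Arrow (unit_obj C) (unit_obj C) (dag C (funit X) \<cdot> funit X))"
    "X.closure (arrow c) = arrow_scl C \<nu> (Arrow (unit_obj C) (unit_obj C) (dag C (funit X) \<cdot> funit X))"
    "X.closure (arrow F) = arrow_scl C \<nu> (X.closure (arrow b))"
    and Fb: "F \<cdot> b = scl C \<mu> b" and Fc: "F \<cdot> c = scl C \<mu> c" and FF: "F \<cdot> F = scl C \<mu> F"
    using X.conv_biprojections[OF bip] unfolding F by (auto simp: arrow_defs)
  have "X.closure (arrow b) = Arrow (unit_obj C) (unit_obj C) (scl C (tr b) (ident C (unit_obj C)))"
    using tr_eq[OF bH(1)] by (simp add: X.closure_def arrow_defs bend_def cup_def cap_def)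
  then have trF: "tr F = \<nu> * tr b"
    using tr_closure mn(3) by metis
  have trc: "tr c = \<nu> * s" and trbc: "tr (b \<cdot> c) = \<mu> * s"
    using tr_closure[OF mn(2) s] tr_closure[OF mn(1) s] by auto
  have "tr b \<noteq> 0" "tr c \<noteq> 0"
    using tr_dag_comp(3)[OF bH(1)] tr_dag_comp(3)[OF cH(1)] bH cH
      biprojection_nonzero[OF b] biprojection_nonzero[OF c] by (auto simp: projection_def)
  then have "tr F \<noteq> 0"
    using trF trc by auto
  have s_real: "Im s = 0"
    using dag_comp_scalar(1)[OF X_Hom(2) s] .
  have "tr b = complex_of_real (Re (tr b))" "tr c = complex_of_real (Re (tr c))"
    "s = complex_of_real (Re s)"
    using tr_projection bH cH s_real by (simp_all add: complex_eq_iff)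
  moreover have "\<nu> = tr c / s"
    using trc \<open>tr c \<noteq> 0\<close> by auto
  ultimately have trF_real: "Im (tr F) = 0"
    unfolding trF by (metis Im_complex_of_real of_real_divide of_real_mult)
  have trFF: "tr (dag C F \<cdot> F) = \<mu> * tr F"
    using FH FF tr_scl by simp
  have "\<mu> \<noteq> 0"
  proof
    assume "\<mu> = 0"
    then have "F = 0"
      using trFF tr_dag_comp(3)[OF FH(1)] by simp
    then show False
      using \<open>tr F \<noteq> 0\<close> tr_scl[OF Hom_zero, of 0] by simp
  qed
  have "Im \<mu> = 0"
    using tr_dag_comp(1)[OF FH(1)] trF_real \<open>tr F \<noteq> 0\<close> unfolding trFF by (auto simp: complex_eq_iff)
  then have mu_real: "cnj \<mu> = \<mu>"
    by (simp add: complex_eq_iff)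
  define p where "p = scl C (1 / \<mu>) F"
  show ?thesis
  proof
    show "projection p"
      unfolding projection_def p_def
      using FH FF \<open>\<mu> \<noteq> 0\<close> mu_real
      by (simp add: Hom_scl dag_scl[OF FH(1)] comp_scl_left[OF Hom_scl FH(1), OF FH(1)] comp_scl_right[OF FH(1) FH(1)])
    show "p \<cdot> b = b" "p \<cdot> c = c"
      unfolding p_def using \<open>\<mu> \<noteq> 0\<close>
      by (simp_all add: comp_scl_left[OF bH(1) FH(1)] comp_scl_left[OF cH(1) FH(1)] Fb Fc)
    show "tr (b \<cdot> c) * tr p = tr b * tr c"
      unfolding p_def tr_scl[OF FH(1)] trF trc trbc using \<open>\<mu> \<noteq> 0\<close> by simp
  qed
qed

lemma projection_diff:
  assumes "projection p" "projection b" "p \<cdot> b = b"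
  shows "projection (p - b)"
proof -
  have H: "p \<in> Hom C (fobj X) (fobj X)" "b \<in> Hom C (fobj X) (fobj X)"
    using assms by (auto simp: projection_def)
  have "b \<cdot> p = b"
    using arg_cong[OF assms(3), of "dag C"] assms(1,2) dag_comp[OF H(2,1)] by (simp add: projection_def)
  then show ?thesis
    using assms H unfolding projection_def
    by (simp add: Hom_diff dag_diff[OF H] comp_diff_left[OF Hom_diff] comp_diff_right)
qed

text \<open>
  This is the estimate \<open>\<parallel>b - c\<parallel>\<^sup>2 \<ge> \<kappa>\<^sup>2 / T\<close> in terms of \<open>\<beta> = tr b\<close>, \<open>\<gamma> = tr c\<close>, \<open>\<tau> = tr (b \<cdot> c)\<close> and
  \<open>\<pi> = tr p\<close>. It rests on
  \<open>\<pi> (\<beta> + \<gamma> - 2 \<tau>) = \<beta> (\<pi> - \<gamma>) + \<gamma> (\<pi> - \<beta>)\<close>.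
\<close>

lemma real_separation:
  fixes \<beta> \<gamma> \<pi> \<tau> \<kappa> T :: real
  assumes "\<tau> * \<pi> = \<beta> * \<gamma>" "\<kappa> \<le> \<beta>" "\<kappa> \<le> \<gamma>" "0 < \<kappa>" "\<beta> + \<kappa> \<le> \<pi>" "\<gamma> \<le> \<pi>" "\<pi> \<le> T"
  shows "\<kappa>\<^sup>2 / T \<le> \<beta> + \<gamma> - 2 * \<tau>"
proof -
  have "\<pi> > 0"
    using assms by linarith
  have "\<kappa> * \<kappa> \<le> \<beta> * (\<pi> - \<gamma>) + \<gamma> * (\<pi> - \<beta>)"
    using mult_mono[of \<kappa> \<gamma> \<kappa> "\<pi> - \<beta>"] mult_nonneg_nonneg[of \<beta> "\<pi> - \<gamma>"] assms by linarith
  also have "\<dots> = \<pi> * (\<beta> + \<gamma> - 2 * \<tau>)"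
    using assms(1) by (simp add: algebra_simps)
  finally have "\<kappa>\<^sup>2 / \<pi> \<le> \<beta> + \<gamma> - 2 * \<tau>"
    using \<open>\<pi> > 0\<close> by (simp add: field_simps power2_eq_square)
  moreover have "\<kappa>\<^sup>2 / T \<le> \<kappa>\<^sup>2 / \<pi>"
    using \<open>\<pi> > 0\<close> assms by (intro divide_left_mono) auto
  ultimately show ?thesis
    by linarith
qed

lemma finite_biprojections: "finite biprojections"
proof -
  let ?S = "Hom C (fobj X) (fobj X)" and ?i = "ident C (fobj X)"
  interpret hermitian_space "scl C" ?S "\<lambda>f g. tr (dag C f \<cdot> g)"
  proof unfold_locales
    show "subspace ?S"
      by (rule subspace_Hom)
    show "tr (dag C f \<cdot> (g + h)) = tr (dag C f \<cdot> g) + tr (dag C f \<cdot> h)"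
      if "f \<in> ?S" "g \<in> ?S" "h \<in> ?S" for f g h
      using that by (simp add: comp_add_right[OF _ _ dag_in_Hom] tr_add comp_in_Hom[OF _ dag_in_Hom])
    show "tr (dag C f \<cdot> scl C z g) = z * tr (dag C f \<cdot> g)" if "f \<in> ?S" "g \<in> ?S" for f g z
      using that by (simp add: comp_scl_right[OF _ dag_in_Hom] tr_scl comp_in_Hom[OF _ dag_in_Hom])
    show "tr (dag C g \<cdot> f) = cnj (tr (dag C f \<cdot> g))" if "f \<in> ?S" "g \<in> ?S" for f g
      using that by (rule tr_dag_comp_sym)
  qed (use tr_dag_comp in auto)
  obtain S where S: "finite S" "span S = ?S"
    using Hom_finite_dim by blast
  obtain \<kappa> where \<kappa>: "\<kappa> > 0" "\<And>q. projection q \<Longrightarrow> q \<noteq> 0 \<Longrightarrow> \<kappa> \<le> Re (tr q)"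
    using projection_trace_bound by blast
  define T where "T = Re (tr ?i)"
  have le_T: "Re (tr p) \<le> T" if p: "projection p" for p
  proof -
    have "projection ?i"
      by (simp add: projection_def ident_in_Hom dag_ident comp_ident[OF ident_in_Hom])
    moreover have pH: "p \<in> ?S"
      using p by (simp add: projection_def)
    ultimately have "projection (?i - p)"
      using projection_diff p ident_comp[OF pH] by blast
    then show ?thesis
      using tr_projection(2)[of "?i - p"] tr_diff[OF ident_in_Hom pH] by (simp add: T_def)
  qed
  have sep: "\<kappa>\<^sup>2 / T \<le> Re (tr (dag C (b - c) \<cdot> (b - c)))" if bc: "b \<in> biprojections" "c \<in> biprojections" "b \<noteq> c" for b c
  proof -
    note proj = biprojection_projection[OF bc(1)] biprojection_projection[OF bc(2)]
    then have H: "b \<in> ?S" "c \<in> ?S" "dag C b = b" "dag C c = c" "b \<cdot> b = b" "c \<cdot> c = c"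
      by (auto simp: projection_def)
    obtain p where p: "projection p" "p \<cdot> b = b" "p \<cdot> c = c" and tr_p: "tr (b \<cdot> c) * tr p = tr b * tr c"
      using join_projection[OF bc(1,2)] by metis
    have pH: "p \<in> ?S"
      using p(1) by (simp add: projection_def)
    note diff = projection_diff[OF p(1) proj(1) p(2)] projection_diff[OF p(1) proj(2) p(3)]
    have le: "Re (tr b) \<le> Re (tr p)" "Re (tr c) \<le> Re (tr p)"
      using diff[THEN tr_projection(2)] H pH by (simp_all add: tr_diff)
    \<comment> \<open>The differences \<open>p - b\<close> and \<open>p - c\<close> are projections, so they vanish or have trace at least \<open>\<kappa>\<close>.\<close>
    have less: "p \<noteq> b \<Longrightarrow> Re (tr b) + \<kappa> \<le> Re (tr p)" "p \<noteq> c \<Longrightarrow> Re (tr c) + \<kappa> \<le> Re (tr p)"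
      using diff[THEN \<kappa>(2)] H pH by (simp_all add: tr_diff)
    have "\<kappa> \<le> Re (tr b)" "\<kappa> \<le> Re (tr c)"
      using \<kappa>(2) proj biprojection_nonzero bc by auto
    moreover have "Re (tr (b \<cdot> c)) * Re (tr p) = Re (tr b) * Re (tr c)"
      using arg_cong[OF tr_p, of Re] tr_projection(1)[OF p(1)] proj[THEN tr_projection(1)] by simp
    ultimately have "\<kappa>\<^sup>2 / T \<le> Re (tr b) + Re (tr c) - 2 * Re (tr (b \<cdot> c))"
      using real_separation[of "Re (tr (b \<cdot> c))" "Re (tr p)" "Re (tr b)" "Re (tr c)" \<kappa> T]
        real_separation[of "Re (tr (b \<cdot> c))" "Re (tr p)" "Re (tr c)" "Re (tr b)" \<kappa> T]
        le less le_T[OF p(1)] bc(3) \<kappa>(1) by (auto simp: mult.commute add.commute)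
    moreover have "tr (dag C (b - c) \<cdot> (b - c)) = tr b + tr c - tr (b \<cdot> c) - tr (c \<cdot> b)"
      using H by (simp add: dag_diff[OF H(1,2)] comp_diff_left[OF Hom_diff] comp_diff_right tr_diff
          comp_in_Hom Hom_diff)
    moreover have "Re (tr (c \<cdot> b)) = Re (tr (b \<cdot> c))"
      using tr_dag_comp_sym[OF H(1,2)] H(3,4) by simp
    ultimately show ?thesis
      by simp
  qed
  have subset: "biprojections \<subseteq> ?S"
    using biprojection_projection by (auto simp: projection_def)
  show ?thesis
  proof (cases "biprojections = {}")
    case False
    then obtain b where "b \<in> biprojections"
      by blast
    then have "T > 0"
      using \<kappa> le_T[OF biprojection_projection[of b]] biprojection_nonzero[of b] biprojection_projection[of b] by force
    show ?thesis
    proof (rule finite_separated[OF S subset])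
      show "Re (tr (dag C b \<cdot> b)) \<le> T" if "b \<in> biprojections" for b
        using le_T[OF biprojection_projection[OF that]] biprojection_projection[OF that]
        by (simp add: projection_def)
      show "\<kappa>\<^sup>2 / T > 0"
        using \<open>T > 0\<close> \<kappa>(1) by simp
    qed (use sep in auto)
  qed simp
qed

lemma sub_proj_biprojection:
  assumes S: "(X', i) \<in> frobenius_subalgebras C X" and U: "unitary_frobenius_algebra C X'"
  shows "sub_proj C X (X', i) \<in> biprojections"
proof -
  have i: "i \<in> Hom C (fobj X') (fobj X)" "i \<cdot> mult X' = mult X \<cdot> (i \<otimes> i)" "i \<cdot> funit X' = funit X"
    and dual: "frob_dual C X' X i \<cdot> i = ident C (fobj X')"
    using S by (auto simp: frobenius_subalgebras_def algebra_mono_def is_mono_def)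
  interpret sub: frobenius_algebra_hom "valid C" src tgt "unit_obj C" "tobj C" "arrow_ident C" "arrow_comp C"
     "arrow_tens C" "arrow_dag C" "arrow_scl C" "fobj X'"
     "Arrow (fobj X' \<boxtimes> fobj X') (fobj X') (mult X')" "Arrow (unit_obj C) (fobj X') (funit X')"
     "fobj X" M E "Arrow (fobj X') (fobj X) i"
    by (intro frobenius_algebra_hom.intro frobenius_algebra_hom_axioms.intro arrow_calculus
        unitary_frobenius_arrows U X.connected_frobenius_object_axioms)
      (use i in \<open>simp_all add: arrow_defs\<close>)
  have com: "comult X' = dag C (mult X')"
    using U by (simp add: unitary_frobenius_algebra_def)
  have "frob_dual C X' X i = dag C i"
    using sub.adj_eq_transpose by (simp add: arrow_defs frob_dual_def dual_mor_def X_Hom(3,4) com)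
  then have b: "sub_proj C X (X', i) = i \<cdot> dag C i" and ii: "dag C i \<cdot> i = ident C (fobj X')"
    using dual by (simp_all add: sub_proj_def)
  have "X.biprojection (arrow (i \<cdot> dag C i))"
    using sub.biprojection_range ii by (simp add: arrow_defs)
  then show ?thesis
    by (simp add: biprojections_def b)
qed

end

theorem corollary9p18:
  fixes C :: "('o, 'm::ab_group_add) dagger_monoidal"
    and X :: "('o, 'm) frobenius"
  assumes "unitary_tensor_category C"
    and "unitary_frobenius_algebra C X"
    and "connected_frobenius C X"
  shows "finite (carrier (unitary_frobenius_subalgebra_lattice C X))"
proof -
  interpret connected_unitary_frobenius C X
    using assms by (intro connected_unitary_frobenius.intro connected_unitary_frobenius_axioms.intro)
  let ?class = "\<lambda>b. {T \<in> frobenius_subalgebras C X. sub_proj C X T = b}"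
  have "carrier (unitary_frobenius_subalgebra_lattice C X) \<subseteq> ?class ` biprojections"
  proof
    fix Q assume "Q \<in> carrier (unitary_frobenius_subalgebra_lattice C X)"
    then obtain S X' i where S: "S \<in> frobenius_subalgebras C X" "Q = sub_equiv C X `` {S}"
      and Xi: "(X', i) \<in> Q" "unitary_frobenius_algebra C X'"
      by (auto simp: unitary_frobenius_subalgebra_lattice_def frobenius_subalgebra_poset_def elim!: quotientE)
    then have T: "(X', i) \<in> frobenius_subalgebras C X" "sub_proj C X (X', i) = sub_proj C X S"
      by (auto simp: sub_equiv_def)
    have "Q = ?class (sub_proj C X (X', i))"
      using S T by (auto simp: sub_equiv_def)
    then show "Q \<in> ?class ` biprojections"
      using sub_proj_biprojection[OF T(1) Xi(2)] by blast
  qed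
  then show ?thesis
    using finite_biprojections finite_surj by blast
qed

end
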